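(* In the Heisenberg group $\mathbb{H}^1$ there exist an open set $\Omega\subset\mathbb{H}^1$, a harmonic function $u$ in $\Omega$ (that is, $\Delta_{\mathbb{H}^1}u=0$ in $\Omega$) and a point $x_0\in\partial\{u>0\}\cap\Omega$ such that $r\mapsto J^{\mathbb{H}^1}_{u,x_0}(r)$ is monotone decreasing in a right neighborhood of $0$. In particular, for every $c_1,c_2\in\mathbb{R}$ such that $c_1^2+c_2^2>0$, the function $$u(x,y,t)=c_1x+c_2y+3t(c_2x-c_1y)-2(c_1x^3+c_2y^3)$$ is harmonic in $\mathbb{H}^1$, $0\in\partial\{u>0\}$, and $r\mapsto J^{\mathbb{H}^1}_{u,0}(r)$ is monotone decreasing in a right neighborhood of $0$.
   Context: The Heisenberg group $\mathbb{H}^1$ is $\mathbb{R}^3$ with points $(x,y,t)$ and the group law $(x,y,t)\circ(x',y',t')=(x+x',y+y',t+t'+2(yx'-xy'))$, for which the vector fields $$X=\frac{\partial}{\partial x}+2y\frac{\partial}{\partial t},\qquad Y=\frac{\partial}{\partial y}-2x\frac{\partial}{\partial t}$$ are left-invariant and form a basis of the horizontal layer. Set $\nabla_{\mathbb{H}^1}f=(Xf,Yf)$ (in the weak sense when needed), $|\nabla_{\mathbb{H}^1}f|^2=(Xf)^2+(Yf)^2$, and $\Delta_{\mathbb{H}^1}=X^2+Y^2$. The homogeneous norm is $|(x,y,t)|_{\mathbb{H}^1}=((x^2+y^2)^2+t^2)^{1/4}$, the fundamental solution of $\Delta_{\mathbb{H}^1}$ is $\Gamma(\eta,\xi)=c\,|\eta^{-1}\circ\xi|_{\mathbb{H}^1}^{-2}$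 with a constant $c>0$, and $D(x_0,r)=\{\xi\in\mathbb{H}^1:|x_0^{-1}\circ\xi|_{\mathbb{H}^1}<r\}$. With $u^+=\max\{u,0\}$ and $u^-=\max\{-u,0\}$, define $$J^{\mathbb{H}^1}_{u,x_0}(r):=\frac1{r^4}\int_{D(x_0,r)}|\nabla_{\mathbb{H}^1}u^+(\xi)|^2\,\Gamma(x_0,\xi)\,d\xi\;\int_{D(x_0,r)}|\nabla_{\mathbb{H}^1}u^-(\xi)|^2\,\Gamma(x_0,\xi)\,d\xi,$$ where $d\xi$ is Lebesgue measure on $\mathbb{R}^3$. A right neighborhood of $0$ is an interval $(0,\delta)$ with $\delta>0$. *)

theory Defs
  imports "HOL-Analysis.Analysis"
begin

type_synonym heis = "real \<times> real \<times> real"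

definition hmult :: "heis \<Rightarrow> heis \<Rightarrow> heis" where
  "hmult = (\<lambda>(x, y, t) (x', y', t'). (x + x', y + y', t + t' + 2 * (y * x' - x * y')))"

definition hinv :: "heis \<Rightarrow> heis" where
  "hinv = (\<lambda>(x, y, t). (- x, - y, - t))"

lemma hmult_hinv: "hmult (hinv p) p = 0" "hmult p (hinv p) = 0"
  by (cases p; simp add: hmult_def hinv_def zero_prod_def)+

definition hnorm :: "heis \<Rightarrow> real" where
  "hnorm = (\<lambda>(x, y, t). root 4 ((x\<^sup>2 + y\<^sup>2)\<^sup>2 + t\<^sup>2))"

(* At the pole, Gamma c p p = c / 0 = 0; this is a single point, of measure zero. *)
definition hGamma :: "real \<Rightarrow> heis \<Rightarrow> heis \<Rightarrow> real" where
  "hGamma c \<eta> \<xi> = c / (hnorm (hmult (hinv \<eta>) \<xi>))\<^sup>2"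

definition hball :: "heis \<Rightarrow> real \<Rightarrow> heis set" where
  "hball x0 r = {\<xi>. hnorm (hmult (hinv x0) \<xi>) < r}"

definition ddir :: "heis \<Rightarrow> (heis \<Rightarrow> real) \<Rightarrow> heis \<Rightarrow> real" where
  "ddir v f p = frechet_derivative f (at p) v"

definition hX :: "(heis \<Rightarrow> real) \<Rightarrow> heis \<Rightarrow> real" where
  "hX f = (\<lambda>(x, y, t). ddir (1, 0, 0) f (x, y, t) + 2 * y * ddir (0, 0, 1) f (x, y, t))"

definition hY :: "(heis \<Rightarrow> real) \<Rightarrow> heis \<Rightarrow> real" where
  "hY f = (\<lambda>(x, y, t). ddir (0, 1, 0) f (x, y, t) - 2 * x * ddir (0, 0, 1) f (x, y, t))"

definition hLaplace :: "(heis \<Rightarrow> real) \<Rightarrow> heis \<Rightarrow> real" where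
  "hLaplace f p = hX (hX f) p + hY (hY f) p"

(* Class C^k, intended for open S. *)
fun Ck_on :: "nat \<Rightarrow> heis set \<Rightarrow> (heis \<Rightarrow> real) \<Rightarrow> bool" where
  "Ck_on 0 S f \<longleftrightarrow> continuous_on S f"
| "Ck_on (Suc k) S f \<longleftrightarrow> (\<forall>p\<in>S. f differentiable (at p)) \<and> (\<forall>v. Ck_on k S (ddir v f))"

definition hharmonic_on :: "heis set \<Rightarrow> (heis \<Rightarrow> real) \<Rightarrow> bool" where
  "hharmonic_on \<Omega> u \<longleftrightarrow> Ck_on 2 \<Omega> u \<and> (\<forall>p\<in>\<Omega>. hLaplace u p = 0)"

definition test_fn :: "heis set \<Rightarrow> (heis \<Rightarrow> real) \<Rightarrow> bool" where
  "test_fn S \<phi> \<longleftrightarrow> (\<forall>k. Ck_on k UNIV \<phi>)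
     \<and> compact (closure {p. \<phi> p \<noteq> 0}) \<and> closure {p. \<phi> p \<noteq> 0} \<subseteq> S"

definition L1_loc :: "heis set \<Rightarrow> (heis \<Rightarrow> real) \<Rightarrow> bool" where
  "L1_loc S f \<longleftrightarrow> (\<forall>K. compact K \<and> K \<subseteq> S \<longrightarrow> set_integrable lborel K f)"

(* The fields X and Y are divergence free, so their formal adjoints are -X and -Y. *)
definition is_weak_hgrad :: "heis set \<Rightarrow> (heis \<Rightarrow> real) \<Rightarrow> (heis \<Rightarrow> real \<times> real) \<Rightarrow> bool" where
  "is_weak_hgrad S f g \<longleftrightarrow>
     L1_loc S f \<and> L1_loc S (\<lambda>p. fst (g p)) \<and> L1_loc S (\<lambda>p. snd (g p)) \<and>
     (\<forall>\<phi>. test_fn S \<phi> \<longrightarrow>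
        (LINT p:S|lborel. f p * hX \<phi> p) = - (LINT p:S|lborel. fst (g p) * \<phi> p) \<and>
        (LINT p:S|lborel. f p * hY \<phi> p) = - (LINT p:S|lborel. snd (g p) * \<phi> p))"

(* A weak gradient is unique up to null sets, so the choice does not affect integrals over
   subsets of S; the value is meaningless when f has no weak gradient on S. *)
definition weak_hgrad :: "heis set \<Rightarrow> (heis \<Rightarrow> real) \<Rightarrow> heis \<Rightarrow> real \<times> real" where
  "weak_hgrad S f = (SOME g. is_weak_hgrad S f g)"

(* The integrals are taken in [0, \<infinity>], so that no integrability is presupposed. *)
definition henergy :: "real \<Rightarrow> heis set \<Rightarrow> (heis \<Rightarrow> real) \<Rightarrow> heis \<Rightarrow> real \<Rightarrow> ennreal" where
  "henergy c \<Omega> v x0 r =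
     (\<integral>\<^sup>+\<xi>\<in>hball x0 r. ennreal (((fst (weak_hgrad \<Omega> v \<xi>))\<^sup>2 + (snd (weak_hgrad \<Omega> v \<xi>))\<^sup>2)
        * hGamma c x0 \<xi>) \<partial>lborel)"

(* The open set \<Omega> is the domain of u; only radii with hball x0 r \<subseteq> \<Omega> are relevant. *)
definition hJ :: "real \<Rightarrow> heis set \<Rightarrow> (heis \<Rightarrow> real) \<Rightarrow> heis \<Rightarrow> real \<Rightarrow> ennreal" where
  "hJ c \<Omega> u x0 r = ennreal (1 / r ^ 4)
     * henergy c \<Omega> (\<lambda>p. max (u p) 0) x0 r * henergy c \<Omega> (\<lambda>p. max (- u p) 0) x0 r"

(* Strictly decreasing: with the non-strict reading, the constant J of u = x would qualify.
   As hJ is strictly decreasing on an open interval, it is finite there. *)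
definition decreasing_near_0 :: "(real \<Rightarrow> ennreal) \<Rightarrow> bool" where
  "decreasing_near_0 F \<longleftrightarrow> (\<exists>\<delta>>0. strict_antimono_on {0<..<\<delta>} F)"

definition u_poly :: "real \<Rightarrow> real \<Rightarrow> heis \<Rightarrow> real" where
  "u_poly c1 c2 = (\<lambda>(x, y, t).
     c1 * x + c2 * y + 3 * t * (c2 * x - c1 * y) - 2 * (c1 * x ^ 3 + c2 * y ^ 3))"

end

theory Submission
  imports Defs
begin

text \<open>
  Why the functional decreases: the polynomial \<open>u = u_poly c1 c2\<close> is odd under
  \<open>(x, y, t) \<mapsto> (- x, - y, t)\<close>, a map that preserves Lebesgue measure and the homogeneous norm.
  The energies of \<open>u\<^sup>+\<close> and \<open>u\<^sup>-\<close> on a ball around \<open>0\<close> are therefore equal, each is half of the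
  energy \<open>E r\<close> of \<open>u\<close>, and \<open>J r = (E r / (2 r\<^sup>2))\<^sup>2\<close> (lemmas \<open>henergy_odd\<close> and \<open>hJ_odd\<close>).
  The squared horizontal gradient of \<open>u\<close> is \<open>c1\<^sup>2 + c2\<^sup>2 - q + s\<close>, where \<open>q\<close> and \<open>s\<close> are
  homogeneous of degrees \<open>2\<close> and \<open>4\<close> for the dilations \<open>(r x, r y, r\<^sup>2 t)\<close>. A change of
  variables gives \<open>E r / r\<^sup>2 = a - b r\<^sup>2 + d r\<^sup>4\<close> (lemma \<open>energy_u_poly\<close>), where \<open>b\<close> is the
  integral of \<open>q\<close> against the fundamental solution over the unit ball. Since
  \<open>q \<ge> 6 (c1\<^sup>2 + c2\<^sup>2) (x\<^sup>2 + y\<^sup>2)\<close>, this integral is positive, so \<open>E r / r\<^sup>2\<close> is strictly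
  decreasing for small \<open>r\<close>; it is nonnegative, hence so is its square.

  Most of the work identifies the weak gradient of \<open>u\<^sup>\<plusminus>\<close>, which is obtained by a choice and so is
  known only through its integrals against test functions. For existence, integration by parts is
  derived from the translation invariance of Lebesgue measure (lemma \<open>integral_ddir_eq_0\<close>) and
  transferred to positive parts by a smooth approximation (lemma \<open>hdir_by_parts_pos\<close>). For
  uniqueness almost everywhere, explicit bump functions approximate the indicators of boxes
  (lemma \<open>AE_zero_if_orthogonal_to_test_fns\<close>). Uniqueness also yields that the gradient of \<open>u\<close>
  vanishes almost everywhere on \<open>u = 0\<close> (lemma \<open>hgrad_zero_on_level_set\<close>), so that the energies
  of \<open>u\<^sup>+\<close> and \<open>u\<^sup>-\<close> add up to the energy of \<open>u\<close>.
\<close>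

section \<open>Smooth functions on the Heisenberg group\<close>

text \<open>
  The function \<open>exp (- 1 / s)\<close>, continued by zero to \<open>s \<le> 0\<close>, is smooth. Dividing it
  by powers of \<open>s\<close> gives a family whose members have derivatives that are linear combinations
  of members, which makes smoothness an induction instead of a computation.
\<close>

definition flat :: "nat \<Rightarrow> real \<Rightarrow> real" where
  "flat k s = (if s > 0 then exp (- inverse s) * inverse s ^ k else 0)"

lemma flat_has_derivative:
  "(flat k has_real_derivative flat (k + 2) s - real k * flat (Suc k) s) (at s)"
proof -
  consider "s > 0" | "s < 0" | "s = 0" by linarith
  then show ?thesis
  proof cases
    case 1
    have "((\<lambda>s. exp (- inverse s) * inverse s ^ k) has_real_derivative
        flat (k + 2) s - real k * flat (Suc k) s) (at s)"
      using 1 by (cases k, auto intro!: derivative_eq_intros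
          simp: flat_def algebra_simps power2_eq_square) (metis One_nat_def power_eq_if)
    then show ?thesis
      by (rule has_field_derivative_transform_within_open[where S = "{0<..}"])
        (use 1 in \<open>auto simp: flat_def\<close>)
  next
    case 2
    have "((\<lambda>s. 0) has_real_derivative flat (k + 2) s - real k * flat (Suc k) s) (at s)"
      using 2 by (auto simp: flat_def)
    then show ?thesis
      by (rule has_field_derivative_transform_within_open[where S = "{..<0}"])
        (use 2 in \<open>auto simp: flat_def\<close>)
  next
    case 3
    have "((\<lambda>h. (flat k h - flat k 0) / (h - 0)) \<longlongrightarrow> 0) (at 0)"
    proof (rule filterlim_split_at)
      show "((\<lambda>h. (flat k h - flat k 0) / (h - 0)) \<longlongrightarrow> 0) (at_left 0)"
        by (rule tendsto_eventually)
          (auto simp: flat_def eventually_at_filter intro!: always_eventually)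
    next
      have "((\<lambda>h::real. inverse h ^ Suc k / exp (inverse h)) \<longlongrightarrow> 0) (at_right 0)"
        using filterlim_compose[OF tendsto_power_div_exp_0 filterlim_inverse_at_top_right] .
      then show "((\<lambda>h. (flat k h - flat k 0) / (h - 0)) \<longlongrightarrow> 0) (at_right 0)"
        by (rule Lim_transform_eventually)
          (auto simp: flat_def eventually_at_filter exp_minus field_simps intro!: always_eventually)
    qed
    then show ?thesis
      using 3 by (simp add: has_field_derivative_iff flat_def)
  qed
qed

lemma continuous_flat: "continuous_on UNIV (flat k)"
  using flat_has_derivative DERIV_isCont continuous_at_imp_continuous_on by blast

lemma flat_nonneg: "0 \<le> flat k s"
  by (simp add: flat_def)

lemma flat_le_1: "k \<le> 1 \<Longrightarrow> flat k s \<le> 1"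
proof -
  assume k: "k \<le> 1"
  show ?thesis
  proof (cases "s > 0")
    case True
    have "inverse s \<le> exp (inverse s)"
      using exp_ge_add_one_self[of "inverse s"] by linarith
    then have "inverse s ^ k \<le> exp (inverse s)"
      using True k by (cases "k = 0") (auto simp: le_Suc_eq)
    then show ?thesis
      using True by (simp add: flat_def exp_minus field_simps)
  qed (simp add: flat_def)
qed

text \<open>
  The case \<open>k = 0\<close> is a smooth approximation of the indicator of the positive axis; the case
  \<open>k = 1\<close> is the error term in the derivative of \<open>s flat 0 (n s)\<close>.
\<close>

lemma flat_scale_limit:
  "(\<lambda>n. flat k (real (Suc n) * s)) \<longlonglongrightarrow> (if k = 0 \<and> s > 0 then 1 else 0)"
proof (cases "s > 0")
  case True
  have i: "(\<lambda>n. inverse (real (Suc n)) * inverse s) \<longlonglongrightarrow> 0 * inverse s"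
    by (intro tendsto_intros LIMSEQ_inverse_real_of_nat)
  have "(\<lambda>n. exp (- (inverse (real (Suc n)) * inverse s)) * (inverse (real (Suc n)) * inverse s) ^ k)
      \<longlonglongrightarrow> exp (- (0 * inverse s)) * (0 * inverse s) ^ k"
    by (intro tendsto_intros i)
  then show ?thesis
    using True by (cases "k = 0") (auto simp: flat_def zero_power simp del: of_nat_Suc)
next
  case False
  then show ?thesis by (simp add: flat_def zero_less_mult_iff)
qed

(* Points of the group are treated as single variables rather than as coordinate triples. *)
declare split_paired_All [simp del] split_paired_Ex [simp del]

lemma ddir_eq: "(f has_derivative f') (at p) \<Longrightarrow> ddir v f p = f' v"
  by (metis ddir_def frechet_derivative_at)

lemma has_derivative_ddir: "f differentiable (at p) \<Longrightarrow> (f has_derivative (\<lambda>v. ddir v f p)) (at p)"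
  using frechet_derivative_works[of f "at p"] by (simp add: ddir_def[abs_def])

text \<open>
  A function is of class \<open>C\<^sup>k\<close> for every \<open>k\<close> as soon as it belongs to a set of differentiable
  functions that is closed under directional derivatives. The set below has this property, and
  it contains both the polynomials and enough bump functions to test with.
\<close>

inductive_set smooth_fn :: "(heis \<Rightarrow> real) set" where
  const: "(\<lambda>p. a) \<in> smooth_fn"
| linear: "bounded_linear l \<Longrightarrow> l \<in> smooth_fn"
| add: "f \<in> smooth_fn \<Longrightarrow> g \<in> smooth_fn \<Longrightarrow> (\<lambda>p. f p + g p) \<in> smooth_fn"
| mult: "f \<in> smooth_fn \<Longrightarrow> g \<in> smooth_fn \<Longrightarrow> (\<lambda>p. f p * g p) \<in> smooth_fn"
| flat: "f \<in> smooth_fn \<Longrightarrow> (\<lambda>p. flat k (f p)) \<in> smooth_fn"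

lemma smooth_fn_ddir:
  assumes "f \<in> smooth_fn"
  shows "(\<forall>p. f differentiable (at p)) \<and> (\<forall>v. ddir v f \<in> smooth_fn)"
  using assms
proof induction
  case (const a)
  have "ddir v (\<lambda>p. a) = (\<lambda>p. 0)" for v
    by (rule ext, rule ddir_eq) (auto intro!: derivative_eq_intros)
  then show ?case by (auto intro: smooth_fn.const)
next
  case (linear l)
  have d: "(l has_derivative l) (at p)" for p
    by (rule bounded_linear_imp_has_derivative[OF linear])
  then have "ddir v l = (\<lambda>p. l v)" for v
    by (intro ext ddir_eq)
  with d show ?case by (auto intro: smooth_fn.const differentiableI)
next
  case (add f g)
  then have d: "((\<lambda>p. f p + g p) has_derivative (\<lambda>v. ddir v f p + ddir v g p)) (at p)" for p
    by (auto intro!: has_derivative_add has_derivative_ddir)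
  then have "ddir v (\<lambda>p. f p + g p) = (\<lambda>p. ddir v f p + ddir v g p)" for v
    by (intro ext ddir_eq)
  with d add show ?case by (auto intro: smooth_fn.add differentiableI)
next
  case (mult f g)
  then have d: "((\<lambda>p. f p * g p) has_derivative (\<lambda>v. f p * ddir v g p + ddir v f p * g p)) (at p)" for p
    by (auto intro!: has_derivative_mult has_derivative_ddir)
  then have "ddir v (\<lambda>p. f p * g p) = (\<lambda>p. f p * ddir v g p + ddir v f p * g p)" for v
    by (intro ext ddir_eq)
  with d mult show ?case by (auto intro!: smooth_fn.add smooth_fn.mult differentiableI)
next
  case (flat f k)
  then have d: "((\<lambda>p. flat k (f p)) has_derivative
      (\<lambda>v. ddir v f p * (flat (k + 2) (f p) + (- real k) * flat (Suc k) (f p)))) (at p)" for p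
    using DERIV_compose_FDERIV[OF flat_has_derivative has_derivative_ddir, of f p k] by simp
  then have e: "ddir v (\<lambda>p. flat k (f p)) =
      (\<lambda>p. ddir v f p * (flat (k + 2) (f p) + (- real k) * flat (Suc k) (f p)))" for v
    by (intro ext ddir_eq)
  have m: "(\<lambda>p. ddir v f p * (flat (k + 2) (f p) + (- real k) * flat (Suc k) (f p))) \<in> smooth_fn" for v
    using flat by (intro smooth_fn.mult smooth_fn.add smooth_fn.const smooth_fn.flat) auto
  show ?case unfolding e using m d differentiableI by blast
qed

lemma smooth_fn_Ck: "f \<in> smooth_fn \<Longrightarrow> Ck_on k UNIV f"
  by (induction k arbitrary: f)
    (auto simp: smooth_fn_ddir intro!: differentiable_imp_continuous_on differentiable_at_imp_differentiable_on)

lemma smooth_fn_prod: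
  "finite I \<Longrightarrow> (\<And>i. i \<in> I \<Longrightarrow> f i \<in> smooth_fn) \<Longrightarrow> (\<lambda>p. \<Prod>i\<in>I. f i p) \<in> smooth_fn"
  by (induction I rule: finite_induct) (auto intro: smooth_fn.const smooth_fn.mult)

section \<open>Continuously differentiable functions and horizontal derivatives\<close>

abbreviation C1 :: "(heis \<Rightarrow> real) \<Rightarrow> bool" where
  "C1 \<equiv> Ck_on (Suc 0) UNIV"

lemma C1_imp_continuous: "C1 f \<Longrightarrow> continuous_on UNIV f"
  by (auto intro!: differentiable_imp_continuous_on differentiable_at_imp_differentiable_on)

lemma C1_mult:
  assumes "C1 f" "C1 g" shows "C1 (\<lambda>p. f p * g p)"
proof -
  have d: "((\<lambda>p. f p * g p) has_derivative (\<lambda>v. f p * ddir v g p + ddir v f p * g p)) (at p)" for p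
    using assms by (auto intro!: has_derivative_mult has_derivative_ddir)
  then have "ddir v (\<lambda>p. f p * g p) = (\<lambda>p. f p * ddir v g p + ddir v f p * g p)" for v
    by (intro ext ddir_eq)
  with d assms show ?thesis
    using C1_imp_continuous[OF assms(1)] C1_imp_continuous[OF assms(2)]
    by (auto intro: differentiableI intro!: continuous_intros)
qed

lemma C1_compose:
  assumes "C1 f" and h: "\<And>s. (h has_real_derivative h' s) (at s)" and h': "continuous_on UNIV h'"
  shows "C1 (\<lambda>p. h (f p))"
proof -
  have d: "((\<lambda>p. h (f p)) has_derivative (\<lambda>v. ddir v f p * h' (f p))) (at p)" for p
    using DERIV_compose_FDERIV[OF h has_derivative_ddir, of f p] assms(1) by simp
  then have "ddir v (\<lambda>p. h (f p)) = (\<lambda>p. ddir v f p * h' (f p))" for v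
    by (intro ext ddir_eq)
  with d assms show ?thesis
    using continuous_on_compose2[OF h' C1_imp_continuous[OF assms(1)]]
    by (auto intro: differentiableI intro!: continuous_intros)
qed

text \<open>
  The derivative along the left-invariant horizontal field \<open>a X + b Y\<close>, so that both fields are
  treated at once.
\<close>

definition hdir :: "real \<Rightarrow> real \<Rightarrow> (heis \<Rightarrow> real) \<Rightarrow> heis \<Rightarrow> real" where
  "hdir a b f p = ddir (a, b, 2 * (a * fst (snd p) - b * fst p)) f p"

lemma hdir_split:
  assumes "f differentiable (at p)"
  shows "hdir a b f p = ddir (a, b, 0) f p + 2 * (a * fst (snd p) - b * fst p) * ddir (0, 0, 1) f p"
proof -
  let ?l = "\<lambda>v. ddir v f p"
  interpret bounded_linear ?l
    using has_derivative_ddir[OF assms] by (rule has_derivative_bounded_linear)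
  have "(a, b, s) = (a, b, 0) + s *\<^sub>R (0, 0, 1)" for s :: real by simp
  then show ?thesis by (metis hdir_def add scaleR real_scaleR_def)
qed

lemma hX_eq_hdir: "f differentiable (at p) \<Longrightarrow> hX f p = hdir 1 0 f p"
  and hY_eq_hdir: "f differentiable (at p) \<Longrightarrow> hY f p = hdir 0 1 f p"
  by (cases p; simp add: hX_def hY_def hdir_split)+

lemma continuous_hdir:
  assumes "C1 f" shows "continuous_on UNIV (hdir a b f)"
proof -
  have "hdir a b f = (\<lambda>p. ddir (a, b, 0) f p + 2 * (a * fst (snd p) - b * fst p) * ddir (0, 0, 1) f p)"
    using assms by (auto simp: hdir_split)
  then show ?thesis using assms by (auto intro!: continuous_intros)
qed

lemma hdir_mult:
  assumes "C1 f" "C1 g"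
  shows "hdir a b (\<lambda>p. f p * g p) p = f p * hdir a b g p + hdir a b f p * g p"
  unfolding hdir_def
  by (rule ddir_eq) (use assms in \<open>auto intro!: has_derivative_mult has_derivative_ddir\<close>)

lemma hdir_compose:
  assumes "C1 f" and h: "\<And>s. (h has_real_derivative h' s) (at s)"
  shows "hdir a b (\<lambda>p. h (f p)) p = hdir a b f p * h' (f p)"
  unfolding hdir_def
  by (rule ddir_eq) (use DERIV_compose_FDERIV[OF h has_derivative_ddir, of f p] assms(1) in simp)

section \<open>Integration by parts\<close>

lemma integrable_bounded_on_compact:
  fixes f g :: "heis \<Rightarrow> real"
  assumes "f \<in> borel_measurable borel" "continuous_on UNIV g" "\<And>p. \<bar>f p\<bar> \<le> g p"
    and K: "compact K" "\<And>p. p \<notin> K \<Longrightarrow> f p = 0"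
  shows "integrable lborel f"
proof -
  have "compact (g ` K)"
    using K assms(2) by (meson compact_continuous_image continuous_on_subset subset_UNIV)
  then obtain B where B: "\<And>p. p \<in> K \<Longrightarrow> \<bar>g p\<bar> \<le> B"
    by (metis bounded_real compact_imp_bounded imageI)
  show ?thesis
  proof (rule integrableI_bounded_set[where A = K and B = B])
    show "emeasure lborel K < \<infinity>"
      by (intro emeasure_bounded_finite compact_imp_bounded K)
    show "AE p in lborel. p \<in> K \<longrightarrow> norm (f p) \<le> B"
      using B assms(3) by (auto intro!: always_eventually) (metis abs_ge_self order_trans)
  qed (use assms K in \<open>auto simp: compact_imp_closed borel_closed\<close>)
qed

lemma integrable_continuous_compact:
  fixes f :: "heis \<Rightarrow> real"
  assumes "continuous_on UNIV f" "compact K" "\<And>p. p \<notin> K \<Longrightarrow> f p = 0"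
  shows "integrable lborel f"
  using assms
  by (intro integrable_bounded_on_compact[where g = "\<lambda>p. \<bar>f p\<bar>" and K = K])
    (auto intro!: continuous_intros borel_measurable_continuous_onI)

lemma ddir_vanish:
  assumes "compact K" "\<And>p. p \<notin> K \<Longrightarrow> f p = 0" "p \<notin> K"
  shows "ddir v f p = 0"
proof -
  have "(f has_derivative (\<lambda>v. 0)) (at p)"
    by (rule has_derivative_transform_within_open[where f = "\<lambda>p. 0" and s = "- K"])
      (use assms in \<open>auto simp: compact_imp_closed open_Compl\<close>)
  then show ?thesis by (simp add: ddir_eq)
qed

lemma lborel_integral_translate:
  fixes f :: "heis \<Rightarrow> real"
  assumes [measurable]: "f \<in> borel_measurable borel"
  shows "(LINT p|lborel. f (p + w)) = (LINT p|lborel. f p)"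
proof -
  have "(LINT p|lborel. f p) = (LINT p|distr lborel borel ((+) w). f p)"
    by (simp add: lborel_distr_plus)
  also have "\<dots> = (LINT p|lborel. f (w + p))"
    by (rule integral_distr) auto
  finally show ?thesis by (simp add: add.commute)
qed

text \<open>
  Lebesgue measure is translation invariant, so every difference quotient of \<open>F\<close> has integral
  zero. The quotients converge to the directional derivative, and by the mean value theorem they
  are bounded by its maximum on a slightly larger compact set; dominated convergence concludes.
\<close>

lemma integral_ddir_eq_0:
  assumes F: "C1 F" and K: "compact K" "\<And>p. p \<notin> K \<Longrightarrow> F p = 0"
  shows "(LINT p|lborel. ddir v F p) = 0"
proof -
  define D where "D n p = (F (p + inverse (real (Suc n)) *\<^sub>R v) - F p) / inverse (real (Suc n))" for n p
  have cF: "continuous_on UNIV F" by (rule C1_imp_continuous[OF F])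
  have cd: "continuous_on UNIV (ddir v F)" using F by simp
  have bF: "F \<in> borel_measurable borel" using cF by (rule borel_measurable_continuous_onI)
  have curve: "((\<lambda>s. F (p + s *\<^sub>R v)) has_real_derivative ddir v F (p + s *\<^sub>R v)) (at s)" for p s
  proof -
    interpret l: bounded_linear "\<lambda>w. ddir w F (p + s *\<^sub>R v)"
      using F by (intro has_derivative_bounded_linear[OF has_derivative_ddir]) auto
    have "((\<lambda>s. F (p + s *\<^sub>R v)) has_derivative (\<lambda>h. ddir (h *\<^sub>R v) F (p + s *\<^sub>R v))) (at s)"
      by (rule has_derivative_compose[where g = F and f = "\<lambda>s. p + s *\<^sub>R v"])
        (use F in \<open>auto intro!: derivative_eq_intros has_derivative_ddir\<close>)
    then show ?thesis
      by (simp add: l.scaleR has_field_derivative_def mult.commute[of _ "ddir v F (p + s *\<^sub>R v)"])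
  qed
  have pos: "inverse (real (Suc n)) > 0" "inverse (real (Suc n)) \<le> 1" for n
    by (auto simp: field_simps)
  have mvt: "\<exists>s\<in>{0..1}. D n p = ddir v F (p + s *\<^sub>R v)" for n p
  proof -
    obtain z where z: "0 < z" "z < inverse (real (Suc n))"
      "F (p + inverse (real (Suc n)) *\<^sub>R v) - F (p + 0 *\<^sub>R v) = (inverse (real (Suc n)) - 0) * ddir v F (p + z *\<^sub>R v)"
      using MVT2[OF pos(1)[of n], of "\<lambda>s. F (p + s *\<^sub>R v)" "\<lambda>s. ddir v F (p + s *\<^sub>R v)"] curve by blast
    then have "D n p = ddir v F (p + z *\<^sub>R v)"
      using pos(1)[of n] by (simp add: D_def del: of_nat_Suc)
    with z pos(2)[of n] show ?thesis by (intro bexI[of _ z]) auto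
  qed
  have van: "ddir v F p = 0" if "p \<notin> K" for p
    by (rule ddir_vanish[OF K that])
  have "compact (ddir v F ` K)"
    using K cd by (meson compact_continuous_image continuous_on_subset subset_UNIV)
  then obtain B0 where "\<And>p. p \<in> K \<Longrightarrow> \<bar>ddir v F p\<bar> \<le> B0"
    by (metis bounded_real compact_imp_bounded imageI)
  then have B: "\<bar>ddir v F p\<bar> \<le> max 0 B0" for p
    using van[of p] by (cases "p \<in> K") (auto simp: le_max_iff_disj)
  obtain R where R: "\<And>p. p \<in> K \<Longrightarrow> norm p \<le> R"
    using K compact_imp_bounded bounded_iff by metis
  define w where "w p = indicator (cball 0 (R + norm v)) p * max 0 B0" for p :: heis
  have bound: "norm (D n p) \<le> w p" for n p
  proof -
    obtain s where s: "s \<in> {0..1}" "D n p = ddir v F (p + s *\<^sub>R v)" using mvt by blast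
    show ?thesis
    proof (cases "p + s *\<^sub>R v \<in> K")
      case True
      have "norm p \<le> norm (p + s *\<^sub>R v) + norm (s *\<^sub>R v)"
        by (metis add_diff_cancel norm_triangle_ineq4)
      also have "norm (s *\<^sub>R v) \<le> norm v"
        using s by (auto intro: mult_left_le_one_le)
      finally have "norm p \<le> R + norm v" using R[OF True] by simp
      then show ?thesis using B s by (simp add: w_def)
    next
      case False
      then show ?thesis using van s by (simp add: w_def)
    qed
  qed
  have "(\<lambda>n. LINT p|lborel. D n p) \<longlonglongrightarrow> (LINT p|lborel. ddir v F p)"
  proof (rule integral_dominated_convergence)
    have [measurable]: "cball 0 (R + norm v) \<in> sets (borel :: heis measure)" by simp
    show "integrable lborel w"
      unfolding w_def
      by (rule integrableI_bounded_set[where A = "cball 0 (R + norm v)" and B = "max 0 B0"])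
        (use emeasure_bounded_finite[of "cball 0 (R + norm v)"] in auto)
    show "AE p in lborel. norm (D n p) \<le> w p" for n using bound by simp
    show "ddir v F \<in> borel_measurable lborel"
      using borel_measurable_continuous_onI[OF cd] by simp
    show "D n \<in> borel_measurable lborel" for n
      unfolding D_def using bF by (auto intro!: borel_measurable_diff borel_measurable_divide
        measurable_compose[OF _ bF])
    show "AE p in lborel. (\<lambda>n. D n p) \<longlonglongrightarrow> ddir v F p"
    proof (rule AE_I2)
      fix p
      have "((\<lambda>h. (F (p + h *\<^sub>R v) - F p) / h) \<longlongrightarrow> ddir v F p) (at 0)"
        using curve[of p 0] by (simp add: has_field_derivative_iff)
      moreover have "filterlim (\<lambda>n. inverse (real (Suc n))) (at 0) sequentially"
        using LIMSEQ_inverse_real_of_nat by (auto simp: filterlim_at intro!: always_eventually)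
      ultimately show "(\<lambda>n. D n p) \<longlonglongrightarrow> ddir v F p"
        unfolding D_def by (rule filterlim_compose)
    qed
  qed
  moreover have "(LINT p|lborel. D n p) = 0" for n
  proof -
    have iF: "integrable lborel F" by (rule integrable_continuous_compact[OF cF K])
    have "integrable lborel (\<lambda>p. F (p + inverse (real (Suc n)) *\<^sub>R v))"
    proof (rule integrable_continuous_compact)
      show "continuous_on UNIV (\<lambda>p. F (p + inverse (real (Suc n)) *\<^sub>R v))"
        by (intro continuous_on_compose2[OF cF] continuous_intros) auto
      show "compact ((\<lambda>p. p - inverse (real (Suc n)) *\<^sub>R v) ` K)"
        by (intro compact_continuous_image continuous_intros K)
      fix p assume "p \<notin> (\<lambda>p. p - inverse (real (Suc n)) *\<^sub>R v) ` K"
      then have "p + inverse (real (Suc n)) *\<^sub>R v \<notin> K" by (metis add_diff_cancel imageI)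
      then show "F (p + inverse (real (Suc n)) *\<^sub>R v) = 0" by (rule K)
    qed
    then show ?thesis
      unfolding D_def using iF lborel_integral_translate[OF bF] by simp
  qed
  ultimately show ?thesis by (simp add: LIMSEQ_const_iff)
qed

lemma hdir_vanish:
  "compact K \<Longrightarrow> (\<And>p. p \<notin> K \<Longrightarrow> f p = 0) \<Longrightarrow> p \<notin> K \<Longrightarrow> hdir a b f p = 0"
  unfolding hdir_def by (rule ddir_vanish)

text \<open>
  The coefficient of \<open>\<partial>/\<partial>t\<close> in \<open>a X + b Y\<close> does not depend on \<open>t\<close>. It can therefore be moved
  under the derivative, which turns the field into a sum of two constant-coefficient derivatives
  of compactly supported functions.
\<close>

lemma integral_hdir_eq_0:
  assumes F: "C1 F" and K: "compact K" "\<And>p. p \<notin> K \<Longrightarrow> F p = 0"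
  shows "(LINT p|lborel. hdir a b F p) = 0"
proof -
  let ?l = "\<lambda>p::heis. 2 * (a * fst (snd p) - b * fst p)"
  have bl: "bounded_linear ?l"
    by (intro bounded_linear_const_mult[of "\<lambda>p. _ p"] bounded_linear_sub bounded_linear_intros)
  then have l: "C1 ?l" by (intro smooth_fn_Ck smooth_fn.linear)
  define G where "G p = ?l p * F p" for p
  have G: "C1 G" unfolding G_def by (rule C1_mult[OF l F])
  have GK: "p \<notin> K \<Longrightarrow> G p = 0" for p using K by (simp add: G_def)
  have "ddir (0, 0, 1) G p = ?l p * ddir (0, 0, 1) F p" for p
  proof -
    have "(G has_derivative (\<lambda>v. ?l p * ddir v F p + ?l v * F p)) (at p)"
      unfolding G_def using F
      by (intro has_derivative_mult has_derivative_ddir bounded_linear_imp_has_derivative bl) auto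
    from ddir_eq[OF this] show ?thesis by simp
  qed
  then have e: "hdir a b F p = ddir (a, b, 0) F p + ddir (0, 0, 1) G p" for p
    using F by (simp add: hdir_split)
  have "integrable lborel (ddir (a, b, 0) F)" "integrable lborel (ddir (0, 0, 1) G)"
    using F G ddir_vanish[OF K] ddir_vanish[OF K(1) GK]
    by (auto intro!: integrable_continuous_compact[OF _ K(1)])
  then show ?thesis
    unfolding e using integral_ddir_eq_0[OF F K] integral_ddir_eq_0[OF G K(1) GK] by simp
qed

lemma hdir_by_parts:
  assumes u: "C1 u" and f: "C1 \<phi>" and K: "compact K" "\<And>p. p \<notin> K \<Longrightarrow> \<phi> p = 0"
  shows "(LINT p|lborel. u p * hdir a b \<phi> p) = - (LINT p|lborel. hdir a b u p * \<phi> p)"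
proof -
  have "(LINT p|lborel. u p * hdir a b \<phi> p + hdir a b u p * \<phi> p) = 0"
    using integral_hdir_eq_0[OF C1_mult[OF u f] K(1)] K by (simp add: hdir_mult[OF u f])
  moreover have "integrable lborel (\<lambda>p. u p * hdir a b \<phi> p)" "integrable lborel (\<lambda>p. hdir a b u p * \<phi> p)"
    using continuous_hdir[OF f] continuous_hdir[OF u] C1_imp_continuous[OF u] C1_imp_continuous[OF f]
      hdir_vanish[OF K] K
    by (auto intro!: integrable_continuous_compact[OF _ K(1)] continuous_intros)
  ultimately show ?thesis by simp
qed

text \<open>
  The positive part is approximated by the functions \<open>s exp (- 1 / (n s))\<close> (zero for \<open>s \<le> 0\<close>).
  They are continuously differentiable, lie between \<open>0\<close> and \<open>max s 0\<close>, and their derivatives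
  lie between \<open>0\<close> and \<open>2\<close> and tend to the indicator of \<open>s > 0\<close> at every \<open>s\<close>, including
  \<open>s = 0\<close>; this makes the limit of the integrands correct on the zero set of \<open>u\<close> as well.
\<close>

lemma hdir_by_parts_pos:
  assumes u: "C1 u" and f: "C1 \<phi>" and K: "compact K" "\<And>p. p \<notin> K \<Longrightarrow> \<phi> p = 0"
  shows "(LINT p|lborel. max (u p) 0 * hdir a b \<phi> p)
       = - (LINT p|lborel. (if u p > 0 then hdir a b u p else 0) * \<phi> p)"
proof -
  define N where "N n = real (Suc n)" for n
  have Npos: "N n > 0" for n by (simp add: N_def)
  define h where "h n s = s * flat 0 (N n * s)" for n s
  define h' where "h' n s = flat 0 (N n * s) + flat 1 (N n * s)" for n s
  have flat2: "N n * s * flat 2 (N n * s) = flat 1 (N n * s)" for n s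
    by (auto simp: flat_def power2_eq_square field_simps)
  have dh: "(h n has_real_derivative h' n s) (at s)" for n s
  proof -
    have "((\<lambda>s. flat 0 (N n * s)) has_real_derivative flat 2 (N n * s) * N n) (at s)"
      using DERIV_chain2[where f = "flat 0" and g = "\<lambda>s. N n * s", OF flat_has_derivative DERIV_cmult_Id]
      by (simp add: numeral_2_eq_2)
    then have "(h n has_real_derivative 1 * flat 0 (N n * s) + flat 2 (N n * s) * N n * s) (at s)"
      unfolding h_def by (intro DERIV_mult DERIV_ident)
    then show ?thesis using flat2[of n s] by (simp add: h'_def mult_ac)
  qed
  have ch': "continuous_on UNIV (h' n)" for n
    unfolding h'_def by (intro continuous_intros continuous_on_compose2[OF continuous_flat]) auto
  have hu: "C1 (\<lambda>p. h n (u p))" for n by (rule C1_compose[OF u dh ch'])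
  define T where "T n p = h n (u p) * hdir a b \<phi> p + h' n (u p) * hdir a b u p * \<phi> p" for n p
  define T0 where "T0 p = max (u p) 0 * hdir a b \<phi> p + (if u p > 0 then hdir a b u p else 0) * \<phi> p" for p
  define w where "w p = \<bar>u p\<bar> * \<bar>hdir a b \<phi> p\<bar> + 2 * \<bar>hdir a b u p\<bar> * \<bar>\<phi> p\<bar>" for p
  note cont = continuous_hdir[OF f, of a b] continuous_hdir[OF u, of a b]
    C1_imp_continuous[OF u] C1_imp_continuous[OF f]
  note meas[measurable] = cont[THEN borel_measurable_continuous_onI]
  have cT: "continuous_on UNIV (T n)" for n
    unfolding T_def
    by (intro continuous_intros cont C1_imp_continuous[OF hu] continuous_on_compose2[OF ch' cont(3)]) auto
  have T_int: "(LINT p|lborel. T n p) = 0" for n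
  proof -
    have "T n = hdir a b (\<lambda>p. h n (u p) * \<phi> p)"
      by (rule ext, unfold T_def hdir_mult[OF hu f] hdir_compose[OF u dh]) (simp add: mult_ac)
    then show ?thesis
      using integral_hdir_eq_0[OF C1_mult[OF hu f] K(1)] K by simp
  qed
  have "(\<lambda>n. LINT p|lborel. T n p) \<longlonglongrightarrow> (LINT p|lborel. T0 p)"
  proof (rule integral_dominated_convergence)
    show "T0 \<in> borel_measurable lborel" unfolding T0_def by measurable
    show "T n \<in> borel_measurable lborel" for n
      using borel_measurable_continuous_onI[OF cT] by simp
    show "integrable lborel w"
      unfolding w_def by (rule integrable_continuous_compact[OF _ K(1)])
        (use cont hdir_vanish[OF K] K in \<open>auto intro!: continuous_intros\<close>)
    show "AE p in lborel. norm (T n p) \<le> w p" for n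
    proof (rule AE_I2)
      fix p
      have f: "0 \<le> flat 0 s" "flat 0 s \<le> 1" "0 \<le> flat 1 s" "flat 1 s \<le> 1" for s
        by (auto simp: flat_nonneg flat_le_1)
      have "\<bar>h n (u p)\<bar> \<le> \<bar>u p\<bar>"
        unfolding h_def abs_mult using f by (intro mult_left_le) auto
      moreover have "\<bar>h' n (u p)\<bar> \<le> 2"
        unfolding h'_def using f[of "N n * u p"] by linarith
      ultimately show "norm (T n p) \<le> w p"
        unfolding T_def w_def real_norm_def
        by (intro order_trans[OF abs_triangle_ineq] add_mono) (auto simp: abs_mult intro!: mult_mono)
    qed
    show "AE p in lborel. (\<lambda>n. T n p) \<longlonglongrightarrow> T0 p"
    proof (rule AE_I2)
      fix p
      have "(\<lambda>n. h n (u p)) \<longlonglongrightarrow> u p * (if u p > 0 then 1 else 0)"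
        unfolding h_def N_def using flat_scale_limit[of 0 "u p"] by (intro tendsto_intros) simp
      moreover have "(\<lambda>n. h' n (u p)) \<longlonglongrightarrow> (if u p > 0 then 1 else 0) + 0"
        unfolding h'_def N_def using flat_scale_limit[of 0 "u p"] flat_scale_limit[of 1 "u p"]
        by (intro tendsto_add) simp_all
      ultimately have "(\<lambda>n. T n p) \<longlonglongrightarrow> u p * (if u p > 0 then 1 else 0) * hdir a b \<phi> p
          + ((if u p > 0 then 1 else 0) + 0) * hdir a b u p * \<phi> p"
        unfolding T_def by (intro tendsto_intros)
      then show "(\<lambda>n. T n p) \<longlonglongrightarrow> T0 p"
        by (simp add: T0_def max_def split: if_splits)
    qed
  qed
  then have "(LINT p|lborel. T0 p) = 0"
    unfolding T_int by (simp add: LIMSEQ_const_iff)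
  moreover have "integrable lborel (\<lambda>p. max (u p) 0 * hdir a b \<phi> p)"
    by (rule integrable_continuous_compact[OF _ K(1)])
      (use cont hdir_vanish[OF K] in \<open>auto intro!: continuous_intros\<close>)
  moreover have "integrable lborel (\<lambda>p. (if u p > 0 then hdir a b u p else 0) * \<phi> p)"
    by (rule integrable_bounded_on_compact[where g = "\<lambda>p. \<bar>hdir a b u p * \<phi> p\<bar>", OF _ _ _ K(1)])
      (use cont K in \<open>auto intro!: continuous_intros simp: abs_mult\<close>)
  ultimately show ?thesis unfolding T0_def by simp
qed

section \<open>Uniqueness of weak horizontal gradients\<close>

lemma L1_loc_bounded:
  assumes "f \<in> borel_measurable borel" "continuous_on UNIV g" "\<And>p. \<bar>f p\<bar> \<le> g p"
  shows "L1_loc UNIV f"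
  unfolding L1_loc_def set_integrable_def
proof safe
  fix K :: "heis set" assume K: "compact K"
  then have [measurable]: "K \<in> sets borel" by (auto simp: compact_imp_closed borel_closed)
  note [measurable] = assms(1)
  show "integrable lborel (\<lambda>p. indicator K p *\<^sub>R f p)"
    by (rule integrable_bounded_on_compact[OF _ assms(2) _ K])
      (use order_trans[OF abs_ge_zero assms(3)] in \<open>auto simp: assms(3) indicator_def\<close>)
qed

lemma L1_loc_mult_integrable:
  assumes f: "L1_loc UNIV f" and c: "continuous_on UNIV \<phi>"
    and K: "compact K" "\<And>p. p \<notin> K \<Longrightarrow> \<phi> p = 0"
  shows "integrable lborel (\<lambda>p. f p * \<phi> p)"
proof -
  have i: "integrable lborel (\<lambda>p. indicator K p * f p)"
    using f K by (auto simp: L1_loc_def set_integrable_def)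
  have "compact (\<phi> ` K)"
    using K c by (meson compact_continuous_image continuous_on_subset subset_UNIV)
  then obtain B where B: "\<And>p. p \<in> K \<Longrightarrow> \<bar>\<phi> p\<bar> \<le> B"
    by (metis bounded_real compact_imp_bounded imageI)
  have [measurable]: "\<phi> \<in> borel_measurable borel" using c by (rule borel_measurable_continuous_onI)
  have "integrable lborel (\<lambda>p. (indicator K p * f p) * \<phi> p)"
  proof (rule Bochner_Integration.integrable_bound[OF integrable_mult_right[OF i, of B]])
    show "(\<lambda>p. indicator K p * f p * \<phi> p) \<in> borel_measurable lborel"
      using borel_measurable_integrable[OF i] by measurable
    show "AE p in lborel. norm (indicator K p * f p * \<phi> p) \<le> norm (B * (indicator K p * f p))"
    proof (rule AE_I2)
      fix p show "norm (indicator K p * f p * \<phi> p) \<le> norm (B * (indicator K p * f p))"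
        using B[of p] by (cases "p \<in> K") (auto simp: abs_mult mult.commute intro!: mult_right_mono)
    qed
  qed
  moreover have "(\<lambda>p. (indicator K p * f p) * \<phi> p) = (\<lambda>p. f p * \<phi> p)"
    using K by (auto simp: fun_eq_iff indicator_def)
  ultimately show ?thesis by simp
qed

lemma test_fnE:
  assumes "test_fn UNIV \<phi>"
  obtains K where "C1 \<phi>" "compact K" "\<And>p. p \<notin> K \<Longrightarrow> \<phi> p = 0"
proof
  show "C1 \<phi>" using assms unfolding test_fn_def by blast
  show "compact (closure {p. \<phi> p \<noteq> 0})" using assms unfolding test_fn_def by blast
  show "p \<notin> closure {p. \<phi> p \<noteq> 0} \<Longrightarrow> \<phi> p = 0" for p
    using closure_subset[of "{p. \<phi> p \<noteq> 0}"] by blast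
qed

text \<open>
  Smooth functions that are supported in a closed box and converge to the indicator of the open
  box from below.
\<close>

definition box_bump :: "heis \<Rightarrow> heis \<Rightarrow> nat \<Rightarrow> heis \<Rightarrow> real" where
  "box_bump a b n p =
     (\<Prod>i\<in>Basis. flat 0 (real (Suc n) * (p \<bullet> i - a \<bullet> i)) * flat 0 (real (Suc n) * (b \<bullet> i - p \<bullet> i)))"

lemma box_bump_le_indicator: "0 \<le> box_bump a b n p \<and> box_bump a b n p \<le> indicator (box a b) p"
proof (cases "p \<in> box a b")
  case True
  then show ?thesis
    by (auto simp: box_bump_def intro!: prod_nonneg prod_le_1 mult_nonneg_nonneg flat_nonneg mult_le_one flat_le_1)
next
  case False
  then obtain i where "i \<in> Basis" "p \<bullet> i \<le> a \<bullet> i \<or> b \<bullet> i \<le> p \<bullet> i"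
    by (auto simp: mem_box not_less)
  then have "box_bump a b n p = 0"
    by (auto simp: box_bump_def flat_def zero_less_mult_iff simp del: of_nat_Suc intro!: prod_zero bexI[of _ i])
  then show ?thesis by simp
qed

lemma box_bump_test_fn: "test_fn UNIV (box_bump a b n)"
proof -
  have [simp]: "(\<lambda>p::heis. s * (p \<bullet> i - r)) \<in> smooth_fn" for s r i
  proof -
    have "(\<lambda>p::heis. s * (p \<bullet> i + (- r))) \<in> smooth_fn"
      by (intro smooth_fn.mult smooth_fn.add smooth_fn.const smooth_fn.linear bounded_linear_inner_left)
    then show ?thesis by simp
  qed
  have [simp]: "(\<lambda>p::heis. s * (r - p \<bullet> i)) \<in> smooth_fn" for s r i
  proof -
    have "(\<lambda>p::heis. (- s) * (p \<bullet> i + (- r))) \<in> smooth_fn"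
      by (intro smooth_fn.mult smooth_fn.add smooth_fn.const smooth_fn.linear bounded_linear_inner_left)
    then show ?thesis by (simp add: algebra_simps)
  qed
  have "box_bump a b n \<in> smooth_fn"
    unfolding box_bump_def[abs_def]
    by (intro smooth_fn_prod smooth_fn.mult[OF smooth_fn.flat smooth_fn.flat]) (simp_all del: of_nat_Suc)
  moreover have s: "closure {p. box_bump a b n p \<noteq> 0} \<subseteq> cbox a b"
  proof (rule closure_minimal)
    show "{p. box_bump a b n p \<noteq> 0} \<subseteq> cbox a b"
    proof
      fix p assume "p \<in> {p. box_bump a b n p \<noteq> 0}"
      then have "p \<in> box a b"
        using box_bump_le_indicator[of a b n p] by (cases "p \<in> box a b") auto
      then show "p \<in> cbox a b" using box_subset_cbox by blast
    qed
  qed (rule closed_cbox)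
  moreover have "compact (closure {p. box_bump a b n p \<noteq> 0})"
    using s by (meson bounded_cbox bounded_subset closed_closure compact_eq_bounded_closed)
  ultimately show ?thesis by (auto simp: test_fn_def smooth_fn_Ck)
qed

lemma box_bump_limit: "(\<lambda>n. box_bump a b n p) \<longlonglongrightarrow> indicator (box a b) p"
proof -
  have l: "(\<lambda>n. flat 0 (real (Suc n) * s)) \<longlonglongrightarrow> (if s > 0 then 1 else 0)" for s
    using flat_scale_limit[of 0 s] by simp
  have "(\<lambda>n. box_bump a b n p) \<longlonglongrightarrow>
      (\<Prod>i\<in>Basis. (if p \<bullet> i - a \<bullet> i > 0 then 1 else 0) * (if b \<bullet> i - p \<bullet> i > 0 then 1 else 0))"
    unfolding box_bump_def by (intro tendsto_prod tendsto_mult l)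
  also have "(\<Prod>i\<in>Basis. (if p \<bullet> i - a \<bullet> i > 0 then 1 else 0) * (if b \<bullet> i - p \<bullet> i > 0 then 1 else 0))
      = (indicator (box a b) p :: real)"
  proof (cases "p \<in> box a b")
    case False
    then obtain i where "i \<in> Basis" "p \<bullet> i \<le> a \<bullet> i \<or> b \<bullet> i \<le> p \<bullet> i"
      by (auto simp: mem_box not_less)
    then show ?thesis using False by (auto intro!: prod_zero bexI[of _ i])
  qed (auto simp: mem_box intro!: prod.neutral)
  finally show ?thesis .
qed

lemma box_Int_boxE:
  fixes a b e f :: "'a::euclidean_space"
  obtains c d where "box a b \<inter> box e f = box c d"
  using box_Int_box[of a b e f] by blast

lemma Int_stable_boxes: "Int_stable (range (\<lambda>(a, b). box a b :: 'a::euclidean_space set))"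
proof (rule Int_stableI)
  fix A B :: "'a set"
  assume "A \<in> range (\<lambda>(a, b). box a b)" "B \<in> range (\<lambda>(a, b). box a b)"
  then obtain a b e f where AB: "A = box a b" "B = box e f" by auto
  obtain c d where "box a b \<inter> box e f = box c d" by (rule box_Int_boxE)
  then have "A \<inter> B = (case (c, d) of (a, b) \<Rightarrow> box a b)" using AB by simp
  then show "A \<inter> B \<in> range (\<lambda>(a, b). box a b)" by (rule range_eqI)
qed

text \<open>
  Testing with the bump functions shows that \<open>h\<close> has integral zero over every open box. The
  boxes are stable under intersection and generate the Borel sets, so within a bounded box \<open>h\<close>
  has integral zero over every Borel set and vanishes almost everywhere.
\<close>

lemma AE_zero_if_orthogonal_to_test_fns:
  assumes h: "L1_loc UNIV h" and orth: "\<And>\<phi>. test_fn UNIV \<phi> \<Longrightarrow> (LINT p|lborel. h p * \<phi> p) = 0"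
  shows "AE p in lborel. h p = 0"
proof -
  have i: "integrable lborel (\<lambda>p. indicator (cbox a b) p * h p)" for a b
    using h by (auto simp: L1_loc_def set_integrable_def)
  have ib: "integrable lborel (\<lambda>p. indicator (box a b) p * h p)" for a b
  proof -
    have "integrable lborel (\<lambda>p. indicator (box a b) p *\<^sub>R (indicator (cbox a b) p * h p))"
      by (intro integrable_mult_indicator i) auto
    moreover have "(\<lambda>p. indicator (box a b) p *\<^sub>R (indicator (cbox a b) p * h p)) = (\<lambda>p. indicator (box a b) p * h p)"
      using box_subset_cbox[of a b] by (auto simp: fun_eq_iff indicator_def)
    ultimately show ?thesis by simp
  qed
  have box0: "(LINT p|lborel. indicator (box a b) p * h p) = 0" for a b
  proof -
    \<comment> \<open>Local integrability gives measurability of \<open>h\<close> only after multiplication by an indicator.\<close>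
    have e: "h p * box_bump a b n p = (indicator (box a b) p * h p) * box_bump a b n p" for n p
      using box_bump_le_indicator[of a b n p] by (cases "p \<in> box a b") auto
    have "(\<lambda>n. LINT p|lborel. h p * box_bump a b n p) \<longlonglongrightarrow> (LINT p|lborel. indicator (box a b) p * h p)"
    proof (rule integral_dominated_convergence[where w = "\<lambda>p. norm (indicator (box a b) p * h p)"])
      show "(\<lambda>p. indicator (box a b) p * h p) \<in> borel_measurable lborel"
        by (rule borel_measurable_integrable[OF ib])
      have "continuous_on UNIV (box_bump a b n)" for n
        using box_bump_test_fn C1_imp_continuous test_fnE by metis
      then have [measurable]: "box_bump a b n \<in> borel_measurable borel" for n
        by (rule borel_measurable_continuous_onI)
      show "(\<lambda>p. h p * box_bump a b n p) \<in> borel_measurable lborel" for n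
        unfolding e using borel_measurable_integrable[OF ib[of a b]] by measurable
      show "AE p in lborel. (\<lambda>n. h p * box_bump a b n p) \<longlonglongrightarrow> indicator (box a b) p * h p"
        by (subst mult.commute) (intro AE_I2 tendsto_intros box_bump_limit)
      show "AE p in lborel. norm (h p * box_bump a b n p) \<le> norm (indicator (box a b) p * h p)" for n
      proof (rule AE_I2)
        fix p
        have "\<bar>box_bump a b n p\<bar> \<le> 1"
          using box_bump_le_indicator[of a b n p] by (cases "p \<in> box a b") auto
        then show "norm (h p * box_bump a b n p) \<le> norm (indicator (box a b) p * h p)"
          unfolding e by (simp add: abs_mult mult_left_le)
      qed
    qed (use ib in simp)
    then show ?thesis
      using orth[OF box_bump_test_fn] by (simp add: LIMSEQ_const_iff)
  qed
  have "AE p in lborel. p \<in> box (- (real N *\<^sub>R One)) (real N *\<^sub>R One) \<longrightarrow> h p = 0" for N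
  proof -
    define B :: "heis set" where "B = box (- (real N *\<^sub>R One)) (real N *\<^sub>R One)"
    define f where "f p = indicator B p * h p" for p
    have f: "integrable lborel f" unfolding f_def B_def by (rule ib)
    have f0: "(LINT p|lborel. f p) = 0" unfolding f_def B_def by (rule box0)
    have si: "set_integrable lborel A f" if "A \<in> sets borel" for A
      unfolding set_integrable_def by (rule integrable_mult_indicator) (use f that in auto)
    have "(LINT p:A|lborel. f p) = 0" if "A \<in> sets borel" for A
    proof -
      note Int_stable_boxes[where 'a = heis]
      moreover have "range (\<lambda>(a, b). box a b :: heis set) \<subseteq> Pow UNIV" by simp
      moreover have "A \<in> sigma_sets UNIV (range (\<lambda>(a, b). box a b))"
        using that by (simp add: borel_eq_box)
      ultimately show ?thesis
      proof (induction rule: sigma_sets_induct_disjoint)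
        case (basic A)
        then obtain a b where A: "A = box a b" by auto
        obtain c d where cd: "box a b \<inter> B = box c d"
          unfolding B_def by (rule box_Int_boxE)
        have "indicator A p *\<^sub>R f p = indicator (box c d) p * h p" for p
          by (simp add: f_def A flip: cd) (simp add: indicator_def)
        then show ?case by (simp add: set_lebesgue_integral_def box0)
      next
        case (compl A)
        then have A: "A \<in> sets borel" by (simp add: borel_eq_box)
        have "f p = indicator A p *\<^sub>R f p + indicator (UNIV - A) p *\<^sub>R f p" for p
          by (auto simp: indicator_def)
        then have "(LINT p|lborel. f p) = (LINT p:A|lborel. f p) + (LINT p:UNIV - A|lborel. f p)"
          using si[OF A] si[of "UNIV - A"] A
          by (simp add: set_lebesgue_integral_def set_integrable_def flip: Bochner_Integration.integral_add)
        then show ?case using compl f0 by simp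
      next
        case (union A)
        then have A: "A i \<in> sets borel" for i by (auto simp: borel_eq_box)
        have "(LINT p:(\<Union>i. A i)|lborel. f p) = (\<Sum>i. LINT p:A i|lborel. f p)"
          by (rule lebesgue_integral_countable_add)
            (use A union si in \<open>auto simp: disjoint_family_on_def\<close>)
        then show ?case using union by simp
      qed (auto simp: set_lebesgue_integral_def)
    qed
    then have "AE p in lborel. f p = 0"
      using f by (intro density_unique_real) (auto simp: set_lebesgue_integral_def)
    then show ?thesis by eventually_elim (auto simp: f_def B_def)
  qed
  then have "AE p in lborel. \<forall>N. p \<in> box (- (real N *\<^sub>R One)) (real N *\<^sub>R One) \<longrightarrow> h p = 0"
    unfolding AE_all_countable by (rule allI)
  then show ?thesis
  proof (rule AE_mp, intro AE_I2 impI)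
    fix p :: heis
    assume *: "\<forall>N. p \<in> box (- (real N *\<^sub>R One)) (real N *\<^sub>R One) \<longrightarrow> h p = 0"
    have "p \<in> (\<Union>N::nat. box (- (real N *\<^sub>R One)) (real N *\<^sub>R One))"
      unfolding UN_box_eq_UNIV by (rule UNIV_I)
    then show "h p = 0" using * by blast
  qed
qed

lemma is_weak_hgrad_iff:
  "is_weak_hgrad UNIV f g \<longleftrightarrow> L1_loc UNIV f \<and> L1_loc UNIV (\<lambda>p. fst (g p)) \<and> L1_loc UNIV (\<lambda>p. snd (g p)) \<and>
    (\<forall>\<phi>. test_fn UNIV \<phi> \<longrightarrow>
      (LINT p|lborel. f p * hdir 1 0 \<phi> p) = - (LINT p|lborel. fst (g p) * \<phi> p) \<and>
      (LINT p|lborel. f p * hdir 0 1 \<phi> p) = - (LINT p|lborel. snd (g p) * \<phi> p))"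
proof -
  have "hX \<phi> = hdir 1 0 \<phi> \<and> hY \<phi> = hdir 0 1 \<phi>" if "test_fn UNIV \<phi>" for \<phi>
  proof -
    have "C1 \<phi>" using that by (rule test_fnE)
    then show ?thesis by (simp add: fun_eq_iff hX_eq_hdir hY_eq_hdir)
  qed
  then show ?thesis
    by (simp add: is_weak_hgrad_def set_lebesgue_integral_def cong: conj_cong)
qed

lemma is_weak_hgrad_unique:
  assumes "is_weak_hgrad UNIV f g" "is_weak_hgrad UNIV f g'"
  shows "AE p in lborel. g p = g' p"
proof -
  have *: "AE p in lborel. k p - k' p = 0"
    if L: "L1_loc UNIV k" "L1_loc UNIV k'"
      and e: "\<And>\<phi>. test_fn UNIV \<phi> \<Longrightarrow> (LINT p|lborel. k p * \<phi> p) = (LINT p|lborel. k' p * \<phi> p)" for k k'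
  proof (rule AE_zero_if_orthogonal_to_test_fns)
    show "L1_loc UNIV (\<lambda>p. k p - k' p)"
      using L by (auto simp: L1_loc_def)
    fix \<phi> assume t: "test_fn UNIV \<phi>"
    then obtain K where K: "C1 \<phi>" "compact K" "\<And>p. p \<notin> K \<Longrightarrow> \<phi> p = 0" by (rule test_fnE) blast
    then have "integrable lborel (\<lambda>p. k p * \<phi> p)" "integrable lborel (\<lambda>p. k' p * \<phi> p)"
      using L by (auto intro!: L1_loc_mult_integrable C1_imp_continuous simp del: Ck_on.simps)
    then show "(LINT p|lborel. (k p - k' p) * \<phi> p) = 0"
      using e[OF t] by (simp add: left_diff_distrib)
  qed
  have "AE p in lborel. fst (g p) - fst (g' p) = 0"
    by (rule *) (use assms in \<open>auto simp: is_weak_hgrad_iff\<close>)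
  moreover have "AE p in lborel. snd (g p) - snd (g' p) = 0"
    by (rule *) (use assms in \<open>auto simp: is_weak_hgrad_iff\<close>)
  ultimately show ?thesis by eventually_elim (auto simp: prod_eq_iff)
qed

lemma weak_hgrad_AE_eq:
  assumes "is_weak_hgrad UNIV f g" shows "AE p in lborel. weak_hgrad UNIV f p = g p"
  unfolding weak_hgrad_def
  by (rule is_weak_hgrad_unique[OF _ assms]) (rule someI[of "is_weak_hgrad UNIV f", OF assms])

section \<open>Weak gradients of continuously differentiable functions\<close>

definition hgrad :: "(heis \<Rightarrow> real) \<Rightarrow> heis \<Rightarrow> real \<times> real" where
  "hgrad u p = (hdir 1 0 u p, hdir 0 1 u p)"

lemma is_weak_hgrad_C1:
  assumes u: "C1 u" shows "is_weak_hgrad UNIV u (hgrad u)"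
  unfolding is_weak_hgrad_iff hgrad_def fst_conv snd_conv
proof (intro conjI allI impI)
  have L: "L1_loc UNIV f" if "continuous_on UNIV f" for f
    by (rule L1_loc_bounded[where g = "\<lambda>p. \<bar>f p\<bar>"])
      (use that in \<open>auto intro!: continuous_intros borel_measurable_continuous_onI\<close>)
  show "L1_loc UNIV u" "L1_loc UNIV (hdir 1 0 u)" "L1_loc UNIV (hdir 0 1 u)"
    by (intro L C1_imp_continuous continuous_hdir u)+
next
  fix \<phi> assume "test_fn UNIV \<phi>"
  then obtain K where K: "C1 \<phi>" "compact K" "\<And>p. p \<notin> K \<Longrightarrow> \<phi> p = 0" by (rule test_fnE) blast
  show "(LINT p|lborel. u p * hdir 1 0 \<phi> p) = - (LINT p|lborel. hdir 1 0 u p * \<phi> p)"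
    by (rule hdir_by_parts[OF u K])
  show "(LINT p|lborel. u p * hdir 0 1 \<phi> p) = - (LINT p|lborel. hdir 0 1 u p * \<phi> p)"
    by (rule hdir_by_parts[OF u K])
qed

lemma is_weak_hgrad_pos_part:
  assumes u: "C1 u"
  shows "is_weak_hgrad UNIV (\<lambda>p. max (u p) 0) (\<lambda>p. if u p > 0 then hgrad u p else 0)"
  unfolding is_weak_hgrad_iff hgrad_def if_distrib[of fst] if_distrib[of snd] fst_conv snd_conv fst_zero snd_zero
proof (intro conjI allI impI)
  note cont = C1_imp_continuous[OF u] continuous_hdir[OF u, of 1 0] continuous_hdir[OF u, of 0 1]
  note [measurable] = borel_measurable_continuous_onI[OF C1_imp_continuous[OF u]]
    borel_measurable_continuous_onI[OF continuous_hdir[OF u]]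
  show "L1_loc UNIV (\<lambda>p. max (u p) 0)"
    by (rule L1_loc_bounded[where g = "\<lambda>p. \<bar>u p\<bar>"]) (use cont in \<open>auto intro!: continuous_intros\<close>)
  show "L1_loc UNIV (\<lambda>p. if 0 < u p then hdir 1 0 u p else 0)"
    by (rule L1_loc_bounded[where g = "\<lambda>p. \<bar>hdir 1 0 u p\<bar>"]) (use cont in \<open>auto intro!: continuous_intros\<close>)
  show "L1_loc UNIV (\<lambda>p. if 0 < u p then hdir 0 1 u p else 0)"
    by (rule L1_loc_bounded[where g = "\<lambda>p. \<bar>hdir 0 1 u p\<bar>"]) (use cont in \<open>auto intro!: continuous_intros\<close>)
next
  fix \<phi> assume "test_fn UNIV \<phi>"
  then obtain K where K: "C1 \<phi>" "compact K" "\<And>p. p \<notin> K \<Longrightarrow> \<phi> p = 0" by (rule test_fnE) blast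
  show "(LINT p|lborel. max (u p) 0 * hdir 1 0 \<phi> p)
      = - (LINT p|lborel. (if u p > 0 then hdir 1 0 u p else 0) * \<phi> p)"
    by (rule hdir_by_parts_pos[OF u K])
  show "(LINT p|lborel. max (u p) 0 * hdir 0 1 \<phi> p)
      = - (LINT p|lborel. (if u p > 0 then hdir 0 1 u p else 0) * \<phi> p)"
    by (rule hdir_by_parts_pos[OF u K])
qed

lemma is_weak_hgrad_add:
  assumes f: "is_weak_hgrad UNIV f g" and f': "is_weak_hgrad UNIV f' g'"
  shows "is_weak_hgrad UNIV (\<lambda>p. f p + f' p) (\<lambda>p. g p + g' p)"
proof -
  have L: "L1_loc UNIV (\<lambda>p. k p + k' p)" if "L1_loc UNIV k" "L1_loc UNIV k'" for k k'
    using that by (auto simp: L1_loc_def)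
  have add: "(LINT p|lborel. (k p + k' p) * \<psi> p) = (LINT p|lborel. k p * \<psi> p) + (LINT p|lborel. k' p * \<psi> p)"
    if "L1_loc UNIV k" "L1_loc UNIV k'" "continuous_on UNIV \<psi>" "compact K" "\<And>p. p \<notin> K \<Longrightarrow> \<psi> p = 0" for k k' \<psi> K
    using L1_loc_mult_integrable[OF that(1) that(3-5)] L1_loc_mult_integrable[OF that(2) that(3-5)]
    by (simp add: distrib_right)
  note w = f[unfolded is_weak_hgrad_iff] f'[unfolded is_weak_hgrad_iff]
  show ?thesis
    unfolding is_weak_hgrad_iff fst_add snd_add
  proof (intro conjI allI impI)
    fix \<phi> assume t: "test_fn UNIV \<phi>"
    then obtain K where K: "C1 \<phi>" "compact K" "\<And>p. p \<notin> K \<Longrightarrow> \<phi> p = 0" by (rule test_fnE) blast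
    note add1 = add[OF _ _ C1_imp_continuous[OF K(1)] K(2,3)]
    note add2 = add[OF _ _ continuous_hdir[OF K(1)] K(2) hdir_vanish[OF K(2,3)]]
    have "(LINT p|lborel. (f p + f' p) * hdir a b \<phi> p)
        = (LINT p|lborel. f p * hdir a b \<phi> p) + (LINT p|lborel. f' p * hdir a b \<phi> p)" for a b
      by (rule add2) (use w in blast)+
    moreover have "(LINT p|lborel. (fst (g p) + fst (g' p)) * \<phi> p)
        = (LINT p|lborel. fst (g p) * \<phi> p) + (LINT p|lborel. fst (g' p) * \<phi> p)"
      by (rule add1) (use w in blast)+
    moreover have "(LINT p|lborel. (snd (g p) + snd (g' p)) * \<phi> p)
        = (LINT p|lborel. snd (g p) * \<phi> p) + (LINT p|lborel. snd (g' p) * \<phi> p)"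
      by (rule add1) (use w in blast)+
    ultimately show
      "(LINT p|lborel. (f p + f' p) * hdir 1 0 \<phi> p) = - (LINT p|lborel. (fst (g p) + fst (g' p)) * \<phi> p)"
      "(LINT p|lborel. (f p + f' p) * hdir 0 1 \<phi> p) = - (LINT p|lborel. (snd (g p) + snd (g' p)) * \<phi> p)"
      using w t by simp_all
  qed (use w in \<open>auto intro!: L\<close>)
qed

lemma hgrad_uminus:
  assumes "C1 u" shows "hgrad (\<lambda>p. - u p) p = - hgrad u p"
proof -
  have "(uminus has_real_derivative -1) (at s)" for s :: real
    by (auto intro!: derivative_eq_intros)
  from hdir_compose[OF assms this] show ?thesis by (simp add: hgrad_def)
qed

lemma C1_uminus: "C1 u \<Longrightarrow> C1 (\<lambda>p. - u p)"
  by (rule C1_compose[where h = uminus and h' = "\<lambda>_. -1"]) (auto intro!: derivative_eq_intros)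

text \<open>
  The positive part has the weak gradient \<open>\<nabla>u\<close> restricted to \<open>u > 0\<close>. Since
  \<open>u\<^sup>+ = u + (- u)\<^sup>+\<close>, it also has the weak gradient \<open>\<nabla>u\<close> restricted to \<open>u \<ge> 0\<close>. By uniqueness
  the two agree almost everywhere.
\<close>

lemma hgrad_zero_on_level_set:
  assumes u: "C1 u" shows "AE p in lborel. u p = 0 \<longrightarrow> hgrad u p = 0"
proof -
  have "is_weak_hgrad UNIV (\<lambda>p. u p + max (- u p) 0)
      (\<lambda>p. hgrad u p + (if - u p > 0 then hgrad (\<lambda>p. - u p) p else 0))"
    by (intro is_weak_hgrad_add is_weak_hgrad_C1 is_weak_hgrad_pos_part u C1_uminus)
  moreover have "(\<lambda>p. u p + max (- u p) 0) = (\<lambda>p. max (u p) 0)" by auto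
  ultimately have "AE p in lborel. hgrad u p + (if - u p > 0 then hgrad (\<lambda>p. - u p) p else 0)
      = (if u p > 0 then hgrad u p else 0)"
    by (intro is_weak_hgrad_unique[OF _ is_weak_hgrad_pos_part[OF u]]) simp
  then show ?thesis by eventually_elim auto
qed

section \<open>Dilations and the singular kernel\<close>

text \<open>
  The anisotropic dilations are, for \<open>r > 0\<close>, automorphisms of the group; they scale the norm by
  \<open>r\<close> and Lebesgue measure by \<open>r\<^sup>4\<close>.
\<close>

definition dil :: "real \<Rightarrow> heis \<Rightarrow> heis" where
  "dil r p = (r * fst p, r * fst (snd p), r\<^sup>2 * snd (snd p))"

lemma nn_integral_diagonal:
  fixes f :: "heis \<Rightarrow> ennreal"
  assumes [measurable]: "f \<in> borel_measurable borel" and "a \<noteq> 0" "b \<noteq> 0" "c \<noteq> 0"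
  shows "(\<integral>\<^sup>+p. f p \<partial>lborel) =
    ennreal \<bar>a * b * c\<bar> * (\<integral>\<^sup>+p. f (a * fst p, b * fst (snd p), c * snd (snd p)) \<partial>lborel)"
proof -
  let ?T = "\<lambda>p::heis. (a * fst p, b * fst (snd p), c * snd (snd p))"
  have B: "(Basis :: heis set) = {(1, 0, 0), (0, 1, 0), (0, 0, 1)}"
    by (auto simp: Basis_prod_def zero_prod_def)
  have T: "0 + (\<Sum>j\<in>Basis. (((a, b, c) \<bullet> j) * (p \<bullet> j)) *\<^sub>R j) = ?T p" for p :: heis
    by (cases p) (simp add: B)
  have nz: "(a, b, c) \<bullet> j \<noteq> 0" if "j \<in> Basis" for j :: heis
    using that assms(2-4) by (auto simp: B)
  have [measurable]: "?T \<in> borel \<rightarrow>\<^sub>M borel"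
    by (intro borel_measurable_continuous_onI continuous_intros)
  have "lborel = density (distr lborel borel ?T) (\<lambda>_. ennreal (\<Prod>j\<in>Basis. \<bar>(a, b, c) \<bullet> j\<bar>))"
    using lborel_affine_euclidean[where c = "\<lambda>j. (a, b, c) \<bullet> j" and t = "0 :: heis", OF nz] unfolding T .
  also have "(\<Prod>j\<in>Basis. \<bar>(a, b, c) \<bullet> j\<bar>) = \<bar>a * b * c\<bar>"
    by (simp add: B abs_mult)
  finally have "(\<integral>\<^sup>+p. f p \<partial>lborel) = (\<integral>\<^sup>+p. f p \<partial>density (distr lborel borel ?T) (\<lambda>_. ennreal \<bar>a * b * c\<bar>))"
    by simp
  also have "\<dots> = ennreal \<bar>a * b * c\<bar> * (\<integral>\<^sup>+p. f (?T p) \<partial>lborel)"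
    by (simp add: nn_integral_density nn_integral_cmult nn_integral_distr)
  finally show ?thesis .
qed

lemma nn_integral_dil:
  fixes f :: "heis \<Rightarrow> ennreal"
  assumes "f \<in> borel_measurable borel" "r > 0"
  shows "(\<integral>\<^sup>+p. f p \<partial>lborel) = ennreal (r ^ 4) * (\<integral>\<^sup>+p. f (dil r p) \<partial>lborel)"
  using nn_integral_diagonal[OF assms(1), of r r "r\<^sup>2"] assms(2)
  by (simp add: dil_def power2_eq_square numeral_eq_Suc mult.assoc)

lemma hnorm_eq: "hnorm p = root 4 (((fst p)\<^sup>2 + (fst (snd p))\<^sup>2)\<^sup>2 + (snd (snd p))\<^sup>2)"
  by (cases p) (simp add: hnorm_def)

lemma hnorm_nonneg: "0 \<le> hnorm p"
  by (simp add: hnorm_eq)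

lemma continuous_hnorm: "continuous_on UNIV hnorm"
  unfolding hnorm_eq[abs_def] by (intro continuous_intros)

lemma measurable_hnorm[measurable]: "hnorm \<in> borel_measurable borel"
  by (rule borel_measurable_continuous_onI[OF continuous_hnorm])

lemma hnorm_dil:
  assumes "r > 0" shows "hnorm (dil r p) = r * hnorm p"
proof -
  have "((r * fst p)\<^sup>2 + (r * fst (snd p))\<^sup>2)\<^sup>2 + (r\<^sup>2 * snd (snd p))\<^sup>2
      = r ^ 4 * (((fst p)\<^sup>2 + (fst (snd p))\<^sup>2)\<^sup>2 + (snd (snd p))\<^sup>2)"
    by algebra
  moreover have "root 4 (r ^ 4) = r" using assms by (simp add: real_root_power_cancel)
  ultimately show ?thesis by (simp add: hnorm_eq dil_def real_root_mult)
qed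

lemma hball_0: "hball 0 r = {p. hnorm p < r}"
proof -
  have "hmult (hinv 0) p = p" for p by (cases p) (simp add: hmult_def hinv_def zero_prod_def)
  then show ?thesis by (simp add: hball_def)
qed

lemma hGamma_0: "hGamma c 0 p = c / (hnorm p)\<^sup>2"
proof -
  have "hmult (hinv 0) p = p" by (cases p) (simp add: hmult_def hinv_def zero_prod_def)
  then show ?thesis by (simp add: hGamma_def)
qed

lemma hnorm_less_1D:
  assumes "hnorm p < 1"
  shows "\<bar>fst p\<bar> \<le> 1" "\<bar>fst (snd p)\<bar> \<le> 1" "\<bar>snd (snd p)\<bar> \<le> 1"
proof -
  let ?x = "fst p" and ?y = "fst (snd p)" and ?t = "snd (snd p)"
  have *: "(?x\<^sup>2 + ?y\<^sup>2)\<^sup>2 + ?t\<^sup>2 < 1"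
    using assms by (simp add: hnorm_eq)
  then have "?t\<^sup>2 \<le> 1" "(?x\<^sup>2 + ?y\<^sup>2)\<^sup>2 \<le> 1"
    using zero_le_power2[of "?t"] zero_le_power2[of "?x\<^sup>2 + ?y\<^sup>2"] by linarith+
  then have "\<bar>?t\<bar> \<le> 1" "?x\<^sup>2 + ?y\<^sup>2 \<le> 1"
    by (auto simp: abs_square_le_1 abs_le_iff)
  moreover from this have "?x\<^sup>2 \<le> 1" "?y\<^sup>2 \<le> 1"
    using zero_le_power2[of ?x] zero_le_power2[of ?y] by linarith+
  ultimately show "\<bar>fst p\<bar> \<le> 1" "\<bar>fst (snd p)\<bar> \<le> 1" "\<bar>snd (snd p)\<bar> \<le> 1"
    by (simp_all add: abs_square_le_1)
qed

lemma unit_hball_subset: "{p. hnorm p < 1} \<subseteq> cbox (-1, -1, -1) (1, 1, 1)"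
proof
  fix p assume "p \<in> {p. hnorm p < 1}"
  then show "p \<in> cbox (-1, -1, -1) (1, 1, 1)"
    using hnorm_less_1D[of p] by (cases p) (auto simp: cbox_Pair_eq)
qed

lemma emeasure_hball:
  assumes "r > 0"
  shows "emeasure lborel {p. hnorm p < r} = ennreal (r ^ 4) * emeasure lborel {p. hnorm p < 1}"
proof -
  have "emeasure lborel {p. hnorm p < r} = (\<integral>\<^sup>+p. indicator {p. hnorm p < r} p \<partial>lborel)"
    by simp
  also have "\<dots> = ennreal (r ^ 4) * (\<integral>\<^sup>+p. indicator {p. hnorm p < r} (dil r p) \<partial>lborel)"
    by (rule nn_integral_dil) (use assms in auto)
  also have "(\<lambda>p. indicator {p. hnorm p < r} (dil r p) :: ennreal) = indicator {p. hnorm p < 1}"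
    using assms by (auto simp: fun_eq_iff indicator_def hnorm_dil)
  finally show ?thesis by simp
qed

lemma dyadic_bracket:
  fixes h :: real
  assumes "0 < h" "h < 1"
  obtains k where "(1/2) ^ Suc k \<le> h" "h < (1/2) ^ k"
proof -
  obtain n where "(1/2) ^ n < h"
    using real_arch_pow_inv[OF assms(1), of "1/2"] by auto
  then have ex: "(1/2) ^ n \<le> h" by simp
  define m where "m = (LEAST n. (1/2) ^ n \<le> h)"
  have m: "(1/2) ^ m \<le> h" unfolding m_def by (rule LeastI[of _ n]) (rule ex)
  with assms(2) obtain k where k: "m = Suc k" by (cases m) auto
  have "\<not> (1/2) ^ k \<le> h"
    using k unfolding m_def by (metis lessI not_less_Least)
  then show ?thesis using that m k by auto
qed

text \<open>
  The homogeneous dimension is \<open>4 > 2\<close>: on the dyadic shell where the norm is about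
  \<open>2\<^sup>-\<^sup>k\<close> the kernel is at most \<open>4\<^sup>k\<^sup>+\<^sup>1\<close>, while the ball containing it has volume
  proportional to \<open>16\<^sup>-\<^sup>k\<close>, and the resulting series is geometric.
\<close>

lemma integrable_hnorm_kernel:
  "integrable lborel (\<lambda>p. indicator {p. hnorm p < 1} p / (hnorm p)\<^sup>2)"
proof (rule integrableI_nonneg)
  define V where "V = measure lborel {p. hnorm p < 1}"
  have "emeasure lborel {p. hnorm p < 1} < \<infinity>"
    by (rule emeasure_bounded_finite) (rule bounded_subset[OF bounded_cbox unit_hball_subset])
  then have V: "emeasure lborel {p. hnorm p < 1} = ennreal V"
    by (simp add: V_def emeasure_eq_ennreal_measure less_top)
  have V0: "V \<ge> 0" by (simp add: V_def)
  define F where "F p k = ennreal (4 ^ Suc k) * indicator {p. hnorm p < (1/2) ^ k} p" for p k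
  have bound: "ennreal (indicator {p. hnorm p < 1} p / (hnorm p)\<^sup>2)
      \<le> (\<Sum>k. F p k)" for p
  proof (cases "0 < hnorm p \<and> hnorm p < 1")
    case True
    then obtain k where k: "(1/2) ^ Suc k \<le> hnorm p" "hnorm p < (1/2) ^ k"
      using dyadic_bracket by blast
    have "((1/2) ^ Suc k)\<^sup>2 \<le> (hnorm p)\<^sup>2"
      using k(1) by (intro power_mono) auto
    moreover have "((1/2::real) ^ Suc k)\<^sup>2 = inverse (4 ^ Suc k)"
    proof -
      have "((1/2::real) ^ Suc k)\<^sup>2 = ((1/2)\<^sup>2) ^ Suc k" by (metis power_mult mult.commute)
      also have "(1/2::real)\<^sup>2 = 1/4" by (simp add: power2_eq_square)
      finally show ?thesis by (simp only: power_one_over inverse_eq_divide)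
    qed
    ultimately have "1 / (hnorm p)\<^sup>2 \<le> 4 ^ Suc k"
      using True by (simp add: field_simps)
    then have "ennreal (indicator {p. hnorm p < 1} p / (hnorm p)\<^sup>2)
        \<le> F p k"
      using True k(2) by (simp add: F_def ennreal_leI)
    also have "\<dots> \<le> (\<Sum>k. F p k)"
      using sum_le_suminf[of "F p" "{k}"] by simp
    finally show ?thesis .
  next
    case False
    then have *: "indicator {p. hnorm p < 1} p / (hnorm p)\<^sup>2 = (0 :: real)"
      using hnorm_nonneg[of p] by (cases "hnorm p = 0") auto
    show ?thesis unfolding * by simp
  qed
  have "(\<integral>\<^sup>+p. ennreal (indicator {p. hnorm p < 1} p / (hnorm p)\<^sup>2) \<partial>lborel)
      \<le> (\<integral>\<^sup>+p. (\<Sum>k. F p k) \<partial>lborel)"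
    by (intro nn_integral_mono bound)
  also have "\<dots> = (\<Sum>k. \<integral>\<^sup>+p. ennreal (4 ^ Suc k) * indicator {p. hnorm p < (1/2) ^ k} p \<partial>lborel)"
    unfolding F_def by (rule nn_integral_suminf) measurable
  also have "\<dots> = (\<Sum>k. ennreal (4 ^ Suc k) * emeasure lborel {p. hnorm p < (1/2) ^ k})"
    by (intro suminf_cong nn_integral_cmult_indicator) simp
  also have "\<dots> = (\<Sum>k. ennreal (4 * V * (1/4) ^ k))"
  proof (intro suminf_cong)
    fix k
    have "ennreal (4 ^ Suc k) * emeasure lborel {p. hnorm p < (1/2) ^ k}
        = ennreal (4 ^ Suc k * (((1/2) ^ k) ^ 4 * V))"
      using emeasure_hball[of "(1/2) ^ k"] V0 by (simp add: V ennreal_mult)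
    also have "4 ^ Suc k * (((1/2) ^ k) ^ 4 * V) = 4 * V * (1/4) ^ k"
    proof -
      have "(((1/2::real)) ^ k) ^ 4 = (1/16) ^ k"
        by (simp add: power_mult[symmetric] mult.commute[of k] power_divide) (simp add: power_mult)
      moreover have "(4::real) ^ k * (1/16) ^ k = (1/4) ^ k"
        by (simp add: power_mult_distrib[symmetric])
      ultimately show ?thesis by (simp add: mult_ac) 
    qed
    finally show "ennreal (4 ^ Suc k) * emeasure lborel {p. hnorm p < (1/2) ^ k} = ennreal (4 * V * (1/4) ^ k)" .
  qed
  also have "\<dots> = ennreal (\<Sum>k. 4 * V * (1/4) ^ k)"
    using V0 by (intro suminf_ennreal2) (auto intro!: summable_mult summable_geometric)
  finally show "(\<integral>\<^sup>+p. ennreal (indicator {p. hnorm p < 1} p / (hnorm p)\<^sup>2) \<partial>lborel) < \<infinity>"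
    by (rule order_le_less_trans) simp
qed (auto simp: hnorm_nonneg)

lemma integrable_continuous_times_kernel:
  assumes "continuous_on UNIV f"
  shows "integrable lborel (\<lambda>p. f p * (indicator {p. hnorm p < 1} p / (hnorm p)\<^sup>2))"
proof -
  let ?C = "cbox (-1, -1, -1) (1, 1, 1) :: heis set"
  have "compact (f ` ?C)"
    using assms by (meson compact_cbox compact_continuous_image continuous_on_subset subset_UNIV)
  then obtain B where B: "\<And>p. p \<in> ?C \<Longrightarrow> \<bar>f p\<bar> \<le> B"
    by (metis bounded_real compact_imp_bounded imageI)
  have [measurable]: "f \<in> borel_measurable borel" using assms by (rule borel_measurable_continuous_onI)
  show ?thesis
  proof (rule Bochner_Integration.integrable_bound[OF integrable_mult_right[OF integrable_hnorm_kernel, of B]])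
    show "AE p in lborel. norm (f p * (indicator {p. hnorm p < 1} p / (hnorm p)\<^sup>2))
        \<le> norm (B * (indicator {p. hnorm p < 1} p / (hnorm p)\<^sup>2))"
    proof (rule AE_I2)
      fix p
      show "norm (f p * (indicator {p. hnorm p < 1} p / (hnorm p)\<^sup>2))
        \<le> norm (B * (indicator {p. hnorm p < 1} p / (hnorm p)\<^sup>2))"
      proof (cases "hnorm p < 1")
        case True
        then have "\<bar>f p\<bar> \<le> \<bar>B\<bar>" using B[of p] unit_hball_subset by fastforce
        with True show ?thesis by (simp add: abs_mult divide_right_mono)
      qed simp
    qed
  qed measurable
qed

section \<open>The two energies of an odd function\<close>

definition hgrad_sq :: "(heis \<Rightarrow> real) \<Rightarrow> heis \<Rightarrow> real" where
  "hgrad_sq u p = (hdir 1 0 u p)\<^sup>2 + (hdir 0 1 u p)\<^sup>2"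

lemma hgrad_sq_nonneg: "0 \<le> hgrad_sq u p"
  by (simp add: hgrad_sq_def)

lemma measurable_hgrad_sq:
  assumes "C1 u" shows "hgrad_sq u \<in> borel_measurable borel"
proof -
  note [measurable] = borel_measurable_continuous_onI[OF continuous_hdir[OF assms]]
  show ?thesis unfolding hgrad_sq_def[abs_def] by measurable
qed

lemma measurable_hGamma_0[measurable]: "hGamma c 0 \<in> borel_measurable borel"
  unfolding hGamma_0[abs_def] by measurable

lemma henergy_pos_part:
  assumes u: "C1 u"
  shows "henergy c UNIV (\<lambda>p. max (u p) 0) 0 r
    = (\<integral>\<^sup>+p. ennreal (if hnorm p < r \<and> u p > 0 then hgrad_sq u p * hGamma c 0 p else 0) \<partial>lborel)"
  unfolding henergy_def hball_0
proof (rule nn_integral_cong_AE)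
  show "AE p in lborel. ennreal (((fst (weak_hgrad UNIV (\<lambda>p. max (u p) 0) p))\<^sup>2
      + (snd (weak_hgrad UNIV (\<lambda>p. max (u p) 0) p))\<^sup>2) * hGamma c 0 p) * indicator {p. hnorm p < r} p
    = ennreal (if hnorm p < r \<and> u p > 0 then hgrad_sq u p * hGamma c 0 p else 0)"
    using weak_hgrad_AE_eq[OF is_weak_hgrad_pos_part[OF u]]
    by eventually_elim (simp add: hgrad_def hgrad_sq_def indicator_def)
qed

text \<open>
  The map \<open>(x, y, t) \<mapsto> (- x, - y, t)\<close> preserves Lebesgue measure and the norm and exchanges the
  sets \<open>u > 0\<close> and \<open>u < 0\<close>, so the two energies coincide. Their sum is the full energy, because
  the gradient vanishes almost everywhere on \<open>u = 0\<close>.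
\<close>

lemma henergy_odd:
  assumes u: "C1 u" and odd: "\<And>x y t. u (- x, - y, t) = - u (x, y, t)"
    and even: "\<And>x y t. hgrad_sq u (- x, - y, t) = hgrad_sq u (x, y, t)"
  shows "henergy c UNIV (\<lambda>p. max (- u p) 0) 0 r = henergy c UNIV (\<lambda>p. max (u p) 0) 0 r"
    and "2 * henergy c UNIV (\<lambda>p. max (u p) 0) 0 r
      = (\<integral>\<^sup>+p. ennreal (if hnorm p < r then hgrad_sq u p * hGamma c 0 p else 0) \<partial>lborel)"
proof -
  note [measurable] = measurable_hgrad_sq[OF u] borel_measurable_continuous_onI[OF C1_imp_continuous[OF u]]
  have um: "hgrad_sq (\<lambda>p. - u p) p = hgrad_sq u p" for p
    using hgrad_uminus[OF u, of p] by (simp add: hgrad_def hgrad_sq_def)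
  define P where "P p = ennreal (if hnorm p < r \<and> u p > 0 then hgrad_sq u p * hGamma c 0 p else 0)" for p
  define M where "M p = ennreal (if hnorm p < r \<and> - u p > 0 then hgrad_sq u p * hGamma c 0 p else 0)" for p
  have [measurable]: "P \<in> borel_measurable borel" "M \<in> borel_measurable borel"
    unfolding P_def M_def by measurable
  have EP: "henergy c UNIV (\<lambda>p. max (u p) 0) 0 r = (\<integral>\<^sup>+p. P p \<partial>lborel)"
    unfolding henergy_pos_part[OF u] P_def ..
  have EM: "henergy c UNIV (\<lambda>p. max (- u p) 0) 0 r = (\<integral>\<^sup>+p. M p \<partial>lborel)"
    unfolding henergy_pos_part[OF C1_uminus[OF u]] M_def um ..
  have "M (- fst p, - fst (snd p), snd (snd p)) = P p" for p
    by (cases p) (simp add: M_def P_def odd even hGamma_0 hnorm_eq)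
  then have MP: "(\<integral>\<^sup>+p. M p \<partial>lborel) = (\<integral>\<^sup>+p. P p \<partial>lborel)"
    using nn_integral_diagonal[of M "-1" "-1" 1] by simp
  show "henergy c UNIV (\<lambda>p. max (- u p) 0) 0 r = henergy c UNIV (\<lambda>p. max (u p) 0) 0 r"
    by (simp add: EP EM MP)
  have "2 * (\<integral>\<^sup>+p. P p \<partial>lborel) = (\<integral>\<^sup>+p. P p + M p \<partial>lborel)"
    by (simp add: nn_integral_add MP mult_2)
  also have "\<dots> = (\<integral>\<^sup>+p. ennreal (if hnorm p < r then hgrad_sq u p * hGamma c 0 p else 0) \<partial>lborel)"
  proof (rule nn_integral_cong_AE)
    show "AE p in lborel. P p + M p = ennreal (if hnorm p < r then hgrad_sq u p * hGamma c 0 p else 0)"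
      using hgrad_zero_on_level_set[OF u]
    proof eventually_elim
      case (elim p)
      then show ?case
        by (cases "u p" "0 :: real" rule: linorder_cases) (simp_all add: P_def M_def hgrad_def hgrad_sq_def zero_prod_def)
    qed
  qed
  finally show "2 * henergy c UNIV (\<lambda>p. max (u p) 0) 0 r
      = (\<integral>\<^sup>+p. ennreal (if hnorm p < r then hgrad_sq u p * hGamma c 0 p else 0) \<partial>lborel)"
    by (simp add: EP)
qed

lemma hJ_odd:
  assumes u: "C1 u" and odd: "\<And>x y t. u (- x, - y, t) = - u (x, y, t)"
    and even: "\<And>x y t. hgrad_sq u (- x, - y, t) = hgrad_sq u (x, y, t)"
    and E: "(\<integral>\<^sup>+p. ennreal (if hnorm p < r then hgrad_sq u p * hGamma c 0 p else 0) \<partial>lborel) = ennreal (r\<^sup>2 * G)"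
    and G: "G \<ge> 0" and r: "r > 0"
  shows "hJ c UNIV u 0 r = ennreal ((G / 2)\<^sup>2)"
proof -
  define e where "e = henergy c UNIV (\<lambda>p. max (u p) 0) 0 r"
  have e2: "2 * e = ennreal (r\<^sup>2 * G)" "henergy c UNIV (\<lambda>p. max (- u p) 0) 0 r = e"
    using henergy_odd[OF u odd even] E by (simp_all add: e_def)
  have "e = ennreal (r\<^sup>2 * G / 2)"
  proof (cases e)
    case (real x)
    then have "ennreal (2 * x) = ennreal (r\<^sup>2 * G)"
      using e2(1) by (simp add: ennreal_mult)
    then have "2 * x = r\<^sup>2 * G" using real G by simp
    then show ?thesis using real by simp
  qed (use e2 in \<open>simp add: ennreal_mult_top\<close>)
  then have "hJ c UNIV u 0 r = ennreal (1 / r ^ 4) * ennreal (r\<^sup>2 * G / 2) * ennreal (r\<^sup>2 * G / 2)"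
    using e2(2) by (simp add: hJ_def e_def)
  also have "\<dots> = ennreal (1 / r ^ 4 * (r\<^sup>2 * G / 2) * (r\<^sup>2 * G / 2))"
  proof -
    have "0 \<le> 1 / r ^ 4" "0 \<le> r\<^sup>2 * G / 2" using G r by simp_all
    then show ?thesis by (simp only: ennreal_mult mult_nonneg_nonneg)
  qed
  also have "1 / r ^ 4 * (r\<^sup>2 * G / 2) * (r\<^sup>2 * G / 2) = (G / 2)\<^sup>2"
    using r by (simp add: field_simps power2_eq_square numeral_eq_Suc)
  finally show ?thesis .
qed

section \<open>The harmonic polynomial\<close>

lemma u_poly_eq: "u_poly c1 c2 = (\<lambda>p. c1 * fst p + c2 * fst (snd p)
    + 3 * snd (snd p) * (c2 * fst p - c1 * fst (snd p)) - 2 * (c1 * fst p ^ 3 + c2 * fst (snd p) ^ 3))"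
  by (auto simp: u_poly_def)

lemma smooth_fn_coords:
  "(\<lambda>p. fst p) \<in> smooth_fn" "(\<lambda>p. fst (snd p)) \<in> smooth_fn" "(\<lambda>p. snd (snd p)) \<in> smooth_fn"
  by (intro smooth_fn.linear bounded_linear_intros)+

lemma smooth_fn_u_poly: "u_poly c1 c2 \<in> smooth_fn"
proof -
  have e: "u_poly c1 c2 = (\<lambda>p. c1 * fst p + c2 * fst (snd p)
      + 3 * snd (snd p) * (c2 * fst p + (- c1) * fst (snd p))
      + (- 2) * (c1 * (fst p * (fst p * fst p)) + c2 * (fst (snd p) * (fst (snd p) * fst (snd p)))))"
    by (simp add: u_poly_eq fun_eq_iff power3_eq_cube algebra_simps)
  show ?thesis
    unfolding e by (intro smooth_fn.add smooth_fn.mult smooth_fn.const smooth_fn_coords)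
qed

lemma C1_u_poly: "C1 (u_poly c1 c2)"
  by (rule smooth_fn_Ck[OF smooth_fn_u_poly])

lemma u_poly_has_derivative:
  "(u_poly c1 c2 has_derivative (\<lambda>v. c1 * fst v + c2 * fst (snd v)
     + 3 * (snd (snd v) * (c2 * fst p - c1 * fst (snd p)) + snd (snd p) * (c2 * fst v - c1 * fst (snd v)))
     - 6 * (c1 * (fst p)\<^sup>2 * fst v + c2 * (fst (snd p))\<^sup>2 * fst (snd v)))) (at p)"
  unfolding u_poly_eq
  by (auto intro!: derivative_eq_intros simp: fun_eq_iff algebra_simps)

lemma hX_u_poly: "hX (u_poly c1 c2) = (\<lambda>p. c1 + 3 * c2 * snd (snd p)
    - 6 * c1 * (fst p)\<^sup>2 + 6 * c2 * fst p * fst (snd p) - 6 * c1 * (fst (snd p))\<^sup>2)"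
  using C1_u_poly[of c1 c2]
  by (auto simp: fun_eq_iff hX_eq_hdir hdir_def ddir_eq[OF u_poly_has_derivative] algebra_simps power2_eq_square)

lemma hY_u_poly: "hY (u_poly c1 c2) = (\<lambda>p. c2 - 3 * c1 * snd (snd p)
    - 6 * c2 * (fst (snd p))\<^sup>2 + 6 * c1 * fst p * fst (snd p) - 6 * c2 * (fst p)\<^sup>2)"
  using C1_u_poly[of c1 c2]
  by (auto simp: fun_eq_iff hY_eq_hdir hdir_def ddir_eq[OF u_poly_has_derivative] algebra_simps power2_eq_square)

lemma harmonic_u_poly: "hharmonic_on UNIV (u_poly c1 c2)"
proof -
  have "hLaplace (u_poly c1 c2) p = 0" for p
  proof -
    have dX: "(hX (u_poly c1 c2) has_derivative (\<lambda>v. 3 * c2 * snd (snd v) - 12 * c1 * fst p * fst v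
        + 6 * c2 * (fst v * fst (snd p) + fst p * fst (snd v)) - 12 * c1 * fst (snd p) * fst (snd v))) (at p)"
      unfolding hX_u_poly by (auto intro!: derivative_eq_intros simp: fun_eq_iff algebra_simps)
    have dY: "(hY (u_poly c1 c2) has_derivative (\<lambda>v. - 3 * c1 * snd (snd v) - 12 * c2 * fst (snd p) * fst (snd v)
        + 6 * c1 * (fst v * fst (snd p) + fst p * fst (snd v)) - 12 * c2 * fst p * fst v)) (at p)"
      unfolding hY_u_poly by (auto intro!: derivative_eq_intros simp: fun_eq_iff algebra_simps)
    show ?thesis
      unfolding hLaplace_def hX_eq_hdir[OF differentiableI[OF dX]] hY_eq_hdir[OF differentiableI[OF dY]]
        hdir_def ddir_eq[OF dX] ddir_eq[OF dY]
      by (simp add: algebra_simps)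
  qed
  then show ?thesis
    unfolding hharmonic_on_def using smooth_fn_Ck[OF smooth_fn_u_poly] by blast
qed

lemma zero_in_frontier_u_poly:
  assumes "c1\<^sup>2 + c2\<^sup>2 > 0" shows "0 \<in> frontier {p. u_poly c1 c2 p > 0}"
proof -
  define f where "f s = u_poly c1 c2 (s * c1, s * c2, 0)" for s
  have "(f has_real_derivative c1\<^sup>2 + c2\<^sup>2) (at 0)"
    unfolding f_def u_poly_def by (auto intro!: derivative_eq_intros simp: power2_eq_square)
  from DERIV_pos_inc_right[OF this assms] obtain d
    where d: "d > 0" "\<And>h. 0 < h \<Longrightarrow> h < d \<Longrightarrow> f 0 < f (0 + h)" by blast
  have "0 \<in> closure {p. u_poly c1 c2 p > 0}"
    unfolding closure_approachable
  proof (intro allI impI)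
    fix e :: real assume e: "e > 0"
    define n where "n = norm (c1, c2, 0 :: real)"
    \<comment> \<open>At \<open>h (c1, c2, 0)\<close> the polynomial is positive if \<open>h < d\<close>; the point is near \<open>0\<close> if \<open>h n < e\<close>.\<close>
    define h where "h = min (d / 2) (e / (2 * (n + 1)))"
    have n: "n \<ge> 0" by (simp add: n_def)
    have h: "0 < h" "h < d" using d e n by (auto simp: h_def)
    have "norm (h *\<^sub>R (c1, c2, 0 :: real)) = h * n"
      unfolding n_def norm_scaleR using h by simp
    also have "\<dots> \<le> e / (2 * (n + 1)) * n" using n by (intro mult_right_mono) (auto simp: h_def)
    also have "\<dots> < e" using e n by (simp add: field_simps add_nonneg_pos)
    finally have "dist (h * c1, h * c2, 0 :: real) 0 < e" by (simp add: dist_norm)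
    moreover have "u_poly c1 c2 (h * c1, h * c2, 0) > 0"
      using d(2)[OF h] by (simp add: f_def u_poly_def)
    ultimately show "\<exists>y\<in>{p. u_poly c1 c2 p > 0}. dist y 0 < e" by blast
  qed
  moreover have "0 \<notin> interior {p. u_poly c1 c2 p > 0}"
    using interior_subset[of "{p. u_poly c1 c2 p > 0}"] by (auto simp: u_poly_def zero_prod_def)
  ultimately show ?thesis by (simp add: frontier_def)
qed

text \<open>
  The squared gradient of \<open>u_poly c1 c2\<close> has no component of odd degree for the dilations. Its
  components of degree \<open>0\<close>, \<open>2\<close> and \<open>4\<close> are \<open>c1\<^sup>2 + c2\<^sup>2\<close>, the negative of \<open>quad_part\<close>, and
  \<open>quart_part\<close>. The terms with \<open>c1 c2 t\<close> in degree \<open>2\<close> cancel between the two fields.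
\<close>

definition quad_part :: "real \<Rightarrow> real \<Rightarrow> heis \<Rightarrow> real" where
  "quad_part c1 c2 p = 12 * ((c1\<^sup>2 + c2\<^sup>2) * ((fst p)\<^sup>2 + (fst (snd p))\<^sup>2) - 2 * c1 * c2 * fst p * fst (snd p))"

definition quart_part :: "real \<Rightarrow> real \<Rightarrow> heis \<Rightarrow> real" where
  "quart_part c1 c2 p =
     (3 * c2 * snd (snd p) - 6 * c1 * (fst p)\<^sup>2 + 6 * c2 * fst p * fst (snd p) - 6 * c1 * (fst (snd p))\<^sup>2)\<^sup>2
   + (- 3 * c1 * snd (snd p) - 6 * c2 * (fst (snd p))\<^sup>2 + 6 * c1 * fst p * fst (snd p) - 6 * c2 * (fst p)\<^sup>2)\<^sup>2"

lemma hgrad_sq_u_poly: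
  "hgrad_sq (u_poly c1 c2) p = c1\<^sup>2 + c2\<^sup>2 - quad_part c1 c2 p + quart_part c1 c2 p"
proof -
  have "hdir 1 0 (u_poly c1 c2) p = hX (u_poly c1 c2) p" "hdir 0 1 (u_poly c1 c2) p = hY (u_poly c1 c2) p"
    using C1_u_poly[of c1 c2] by (simp_all add: hX_eq_hdir hY_eq_hdir)
  then show ?thesis
    unfolding hgrad_sq_def hX_u_poly hY_u_poly quad_part_def quart_part_def by algebra
qed

lemma hgrad_sq_u_poly_dil:
  "hgrad_sq (u_poly c1 c2) (dil r p) = c1\<^sup>2 + c2\<^sup>2 - r\<^sup>2 * quad_part c1 c2 p + r ^ 4 * quart_part c1 c2 p"
proof -
  have "quad_part c1 c2 (dil r p) = r\<^sup>2 * quad_part c1 c2 p"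
    unfolding quad_part_def dil_def fst_conv snd_conv by algebra
  moreover have "quart_part c1 c2 (dil r p) = r ^ 4 * quart_part c1 c2 p"
    unfolding quart_part_def dil_def fst_conv snd_conv by algebra
  ultimately show ?thesis by (simp add: hgrad_sq_u_poly)
qed

text \<open>
  This sign is the reason for the counterexample: the correction of lowest order to the energy is
  negative.
\<close>

lemma quad_part_lower_bound:
  "quad_part c1 c2 p \<ge> 6 * ((c1\<^sup>2 + c2\<^sup>2) * ((fst p)\<^sup>2 + (fst (snd p))\<^sup>2))"
proof -
  define x y where "x = fst p" and "y = fst (snd p)"
  have "12 * ((c1\<^sup>2 + c2\<^sup>2) * (x\<^sup>2 + y\<^sup>2) - 2 * c1 * c2 * x * y)
      = 6 * ((c1\<^sup>2 + c2\<^sup>2) * (x\<^sup>2 + y\<^sup>2)) + 6 * ((c1 * x - c2 * y)\<^sup>2 + (c1 * y - c2 * x)\<^sup>2)"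
    by algebra
  then show ?thesis unfolding quad_part_def x_def[symmetric] y_def[symmetric] by simp
qed

section \<open>Expansion and monotonicity of the functional\<close>

lemma continuous_quad_quart:
  "continuous_on UNIV (quad_part c1 c2)" "continuous_on UNIV (quart_part c1 c2)"
  unfolding quad_part_def[abs_def] quart_part_def[abs_def] by (intro continuous_intros)+

definition kernel_integral :: "(heis \<Rightarrow> real) \<Rightarrow> real" where
  "kernel_integral f = (LINT p|lborel. f p * (indicator {p. hnorm p < 1} p / (hnorm p)\<^sup>2))"

lemma kernel_integral_nonneg: "(\<And>p. f p \<ge> 0) \<Longrightarrow> kernel_integral f \<ge> 0"
  unfolding kernel_integral_def by (intro integral_nonneg_AE AE_I2) simp

lemma kernel_integral_quad_part_pos:
  assumes "c1\<^sup>2 + c2\<^sup>2 > 0"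
  shows "kernel_integral (quad_part c1 c2) > 0"
proof (rule ccontr)
  let ?f = "\<lambda>p. quad_part c1 c2 p * (indicator {p. hnorm p < 1} p / (hnorm p)\<^sup>2)"
  have nn: "quad_part c1 c2 p \<ge> 0" for p
    using quad_part_lower_bound[of c1 c2 p] assms
    by (smt (verit) mult_nonneg_nonneg zero_le_power2)
  assume "\<not> ?thesis"
  then have "kernel_integral (quad_part c1 c2) = 0"
    using kernel_integral_nonneg[of "quad_part c1 c2"] nn by simp
  then have ae: "AE p in lborel. ?f p = 0"
    unfolding kernel_integral_def
    by (rule integral_nonneg_eq_0_iff_AE[THEN iffD1, rotated 2])
      (use nn in \<open>simp_all only: integrable_continuous_times_kernel continuous_quad_quart AE_I2
        mult_nonneg_nonneg divide_nonneg_nonneg indicator_pos_le zero_le_power2\<close>)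
  \<comment> \<open>A box inside the unit ball that avoids the \<open>t\<close>-axis, where \<open>quad_part\<close> vanishes.\<close>
  define B :: "heis set" where "B = box (1/4, 0, 0) (1/2, 1/2, 1/2)"
  have nz: "?f p \<noteq> 0" if "p \<in> B" for p
  proof -
    obtain x y t where p: "p = (x, y, t)" by (cases p) auto
    have xyt: "1/4 < x" "x < 1/2" "0 < y" "y < 1/2" "0 < t" "t < 1/2"
      using that by (auto simp: B_def p mem_box Basis_prod_def zero_prod_def)
    have sq: "x\<^sup>2 \<le> (1/2)\<^sup>2" "y\<^sup>2 \<le> (1/2)\<^sup>2" "t\<^sup>2 \<le> (1/2)\<^sup>2"
      using xyt by (auto intro!: power_mono)
    have "(x\<^sup>2 + y\<^sup>2)\<^sup>2 \<le> (1/2)\<^sup>2"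
      using sq by (intro power_mono) (auto simp: power2_eq_square)
    then have "(x\<^sup>2 + y\<^sup>2)\<^sup>2 + t\<^sup>2 < 1"
      using sq by (simp add: power2_eq_square)
    then have "hnorm p < 1" by (simp add: hnorm_eq p)
    moreover have "hnorm p \<noteq> 0"
      using xyt by (auto simp: hnorm_eq p add_nonneg_eq_0_iff)
    moreover have "0 < (c1\<^sup>2 + c2\<^sup>2) * (x\<^sup>2 + y\<^sup>2)"
      using xyt by (intro mult_pos_pos assms add_pos_pos) auto
    then have "quad_part c1 c2 p \<noteq> 0"
      using quad_part_lower_bound[of c1 c2 p] by (simp add: p)
    ultimately show ?thesis by simp
  qed
  from ae have "AE p in lborel. p \<notin> B"
    by eventually_elim (use nz in blast)
  then have "emeasure lborel B = 0"
    by (intro null_setsD1) (simp add: AE_iff_null_sets[symmetric] B_def)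
  then show False
    by (simp add: B_def emeasure_lborel_box_eq Basis_prod_def zero_prod_def)
qed

text \<open>
  The energy of \<open>u_poly c1 c2\<close> on the ball of radius \<open>r\<close>, divided by \<open>r\<^sup>2\<close>.
\<close>

definition normalized_energy :: "real \<Rightarrow> real \<Rightarrow> real \<Rightarrow> real \<Rightarrow> real" where
  "normalized_energy c c1 c2 r = c * ((c1\<^sup>2 + c2\<^sup>2) * kernel_integral (\<lambda>_. 1)
     - r\<^sup>2 * kernel_integral (quad_part c1 c2) + r ^ 4 * kernel_integral (quart_part c1 c2))"

text \<open>
  Rescaling the ball of radius \<open>r\<close> to the unit ball multiplies the measure by \<open>r\<^sup>4\<close> and the
  kernel by \<open>r\<^sup>-\<^sup>2\<close>, and each homogeneous component of the squared gradient by its own power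
  of \<open>r\<close>.
\<close>

lemma energy_u_poly:
  assumes r: "r > 0" and c: "c > 0"
  shows "(\<integral>\<^sup>+p. ennreal (if hnorm p < r then hgrad_sq (u_poly c1 c2) p * hGamma c 0 p else 0) \<partial>lborel)
      = ennreal (r\<^sup>2 * normalized_energy c c1 c2 r)" and "normalized_energy c c1 c2 r \<ge> 0"
proof -
  let ?G = "normalized_energy c c1 c2 r"
  let ?k = "\<lambda>p. indicator {p. hnorm p < 1} p / (hnorm p)\<^sup>2 :: real"
  define F where "F p = c * ((c1\<^sup>2 + c2\<^sup>2) * (1 * ?k p) - r\<^sup>2 * (quad_part c1 c2 p * ?k p)
      + r ^ 4 * (quart_part c1 c2 p * ?k p))" for p
  have F_eq: "F p = c * hgrad_sq (u_poly c1 c2) (dil r p) * ?k p" for p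
    unfolding F_def hgrad_sq_u_poly_dil by (simp only: algebra_simps)
  have F0: "F p \<ge> 0" for p
    unfolding F_eq using c by (simp add: hgrad_sq_nonneg)
  note i = integrable_continuous_times_kernel[OF continuous_on_const[of UNIV "1::real"]]
    integrable_continuous_times_kernel[OF continuous_quad_quart(1)[of c1 c2]]
    integrable_continuous_times_kernel[OF continuous_quad_quart(2)[of c1 c2]]
  have Fi: "integrable lborel F"
    unfolding F_def by (intro integrable_mult_right Bochner_Integration.integrable_add
        Bochner_Integration.integrable_diff i)
  have FG: "(LINT p|lborel. F p) = ?G"
    unfolding F_def normalized_energy_def kernel_integral_def using i
    by (simp only: integral_mult_right_zero Bochner_Integration.integral_add Bochner_Integration.integral_diff
        integrable_mult_right Bochner_Integration.integrable_diff)
  show "?G \<ge> 0"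
    unfolding FG[symmetric] using F0 by (simp add: integral_nonneg_AE)
  note [measurable] = measurable_hgrad_sq[OF C1_u_poly[of c1 c2]]
  have "(\<integral>\<^sup>+p. ennreal (if hnorm p < r then hgrad_sq (u_poly c1 c2) p * hGamma c 0 p else 0) \<partial>lborel)
    = ennreal (r ^ 4) * (\<integral>\<^sup>+p. ennreal (if hnorm (dil r p) < r
        then hgrad_sq (u_poly c1 c2) (dil r p) * hGamma c 0 (dil r p) else 0) \<partial>lborel)"
    by (rule nn_integral_dil[OF _ r]) measurable
  also have "(\<lambda>p. ennreal (if hnorm (dil r p) < r
        then hgrad_sq (u_poly c1 c2) (dil r p) * hGamma c 0 (dil r p) else 0))
      = (\<lambda>p. ennreal (1 / r\<^sup>2) * ennreal (F p))"
  proof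
    fix p
    have "(if hnorm (dil r p) < r then hgrad_sq (u_poly c1 c2) (dil r p) * hGamma c 0 (dil r p) else 0)
        = 1 / r\<^sup>2 * F p"
      using r by (simp add: F_eq hGamma_0 hnorm_dil power_mult_distrib indicator_def)
    then show "ennreal (if hnorm (dil r p) < r
        then hgrad_sq (u_poly c1 c2) (dil r p) * hGamma c 0 (dil r p) else 0)
      = ennreal (1 / r\<^sup>2) * ennreal (F p)"
      using F0 by (simp only: ennreal_mult'')
  qed
  also have "ennreal (r ^ 4) * (\<integral>\<^sup>+p. ennreal (1 / r\<^sup>2) * ennreal (F p) \<partial>lborel)
      = ennreal (r ^ 4) * (ennreal (1 / r\<^sup>2) * ennreal ?G)"
    using nn_integral_eq_integral[OF Fi] F0 Fi by (simp add: nn_integral_cmult FG)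
  also have "\<dots> = ennreal (r ^ 4 * (1 / r\<^sup>2 * ?G))"
  proof -
    have "0 \<le> r ^ 4" "0 \<le> 1 / r\<^sup>2" using r by simp_all
    with \<open>?G \<ge> 0\<close> show ?thesis by (simp only: ennreal_mult mult_nonneg_nonneg)
  qed
  also have "r ^ 4 * (1 / r\<^sup>2 * ?G) = r\<^sup>2 * ?G"
    using r by (simp add: power2_eq_square numeral_eq_Suc)
  finally show "(\<integral>\<^sup>+p. ennreal (if hnorm p < r then hgrad_sq (u_poly c1 c2) p * hGamma c 0 p else 0) \<partial>lborel)
      = ennreal (r\<^sup>2 * ?G)" .
qed

lemma even_quartic_decreasing:
  fixes a b d r s \<delta> :: real
  assumes "d \<ge> 0" "0 < r" "r < s" "s < \<delta>" "2 * d * \<delta>\<^sup>2 \<le> b" "b > 0"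
  shows "a - s\<^sup>2 * b + s ^ 4 * d < a - r\<^sup>2 * b + r ^ 4 * d"
proof -
  have rs: "r\<^sup>2 < s\<^sup>2" "s\<^sup>2 < \<delta>\<^sup>2" using assms by (auto intro!: power_strict_mono)
  have "d * (r\<^sup>2 + s\<^sup>2) < b"
  proof (cases "d = 0")
    case False
    then have "d * (r\<^sup>2 + s\<^sup>2) < d * (2 * \<delta>\<^sup>2)"
      using assms rs by (intro mult_strict_left_mono) auto
    then show ?thesis using assms by simp
  qed (use assms in simp)
  then have "0 < (s\<^sup>2 - r\<^sup>2) * (b - d * (r\<^sup>2 + s\<^sup>2))"
    using rs by simp
  moreover have "(s\<^sup>2 - r\<^sup>2) * (b - d * (r\<^sup>2 + s\<^sup>2)) = (a - r\<^sup>2 * b + r ^ 4 * d) - (a - s\<^sup>2 * b + s ^ 4 * d)"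
    by algebra
  ultimately show ?thesis by simp
qed

lemma hJ_u_poly_decreasing:
  assumes c: "c > 0" and c12: "c1\<^sup>2 + c2\<^sup>2 > 0"
  shows "decreasing_near_0 (hJ c UNIV (u_poly c1 c2) 0)"
proof -
  define G where "G = normalized_energy c c1 c2"
  define a b d where "a = (c1\<^sup>2 + c2\<^sup>2) * kernel_integral (\<lambda>_. 1)"
    and "b = kernel_integral (quad_part c1 c2)" and "d = kernel_integral (quart_part c1 c2)"
  have G: "G r = c * (a - r\<^sup>2 * b + r ^ 4 * d)" for r
    by (simp add: G_def normalized_energy_def a_def b_def d_def)
  have b: "b > 0" unfolding b_def by (rule kernel_integral_quad_part_pos[OF c12])
  have d: "d \<ge> 0" unfolding d_def by (rule kernel_integral_nonneg) (simp add: quart_part_def)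
  have odd: "u_poly c1 c2 (- x, - y, t) = - u_poly c1 c2 (x, y, t)" for x y t
    by (simp add: u_poly_def algebra_simps)
  have even: "hgrad_sq (u_poly c1 c2) (- x, - y, t) = hgrad_sq (u_poly c1 c2) (x, y, t)" for x y t
    by (simp add: hgrad_sq_u_poly quad_part_def quart_part_def)
  have J: "hJ c UNIV (u_poly c1 c2) 0 r = ennreal ((G r / 2)\<^sup>2)" "G r \<ge> 0" if "r > 0" for r
    using hJ_odd[OF C1_u_poly odd even energy_u_poly[OF that c] that] energy_u_poly(2)[OF that c]
    by (simp_all add: G_def)
  \<comment> \<open>Chosen such that \<open>2 d \<delta>\<^sup>2 \<le> b\<close>; the summand \<open>1\<close> covers \<open>d = 0\<close>.\<close>
  define \<delta> where "\<delta> = sqrt (b / (2 * (d + 1)))"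
  have \<delta>: "\<delta> > 0" using b d by (simp add: \<delta>_def)
  have "\<delta>\<^sup>2 = b / (2 * (d + 1))" using b d by (simp add: \<delta>_def)
  then have "2 * \<delta>\<^sup>2 + 2 * d * \<delta>\<^sup>2 = b" using d by (simp add: field_simps)
  then have db: "2 * d * \<delta>\<^sup>2 \<le> b" using zero_le_power2[of \<delta>] by linarith
  have "strict_antimono_on {0<..<\<delta>} (hJ c UNIV (u_poly c1 c2) 0)"
  proof (rule monotone_onI)
    fix r s assume rs: "r \<in> {0<..<\<delta>}" "s \<in> {0<..<\<delta>}" "r < s"
    have "G s < G r"
      unfolding G using even_quartic_decreasing[OF d _ _ _ db b, of r s a] rs c by simp
    then have "(G s / 2)\<^sup>2 < (G r / 2)\<^sup>2"
      using J(2)[of s] rs by (intro power_strict_mono) auto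
    then show "hJ c UNIV (u_poly c1 c2) 0 s < hJ c UNIV (u_poly c1 c2) 0 r"
      using J(1)[of r] J(1)[of s] rs by (simp add: ennreal_less_iff)
  qed
  then show ?thesis unfolding decreasing_near_0_def using \<delta> by blast
qed

theorem corollary1p4:
  fixes c :: real
  assumes "c > 0"
  shows "(\<exists>\<Omega> u x0. open \<Omega> \<and> hharmonic_on \<Omega> u
            \<and> x0 \<in> frontier {p \<in> \<Omega>. u p > 0} \<inter> \<Omega>
            \<and> decreasing_near_0 (hJ c \<Omega> u x0))
       \<and> (\<forall>c1 c2 :: real. c1\<^sup>2 + c2\<^sup>2 > 0 \<longrightarrow>
            hharmonic_on UNIV (u_poly c1 c2)
            \<and> 0 \<in> frontier {p. u_poly c1 c2 p > 0}
            \<and> decreasing_near_0 (hJ c UNIV (u_poly c1 c2) 0))"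
proof -
  have *: "hharmonic_on UNIV (u_poly c1 c2) \<and> 0 \<in> frontier {p. u_poly c1 c2 p > 0}
      \<and> decreasing_near_0 (hJ c UNIV (u_poly c1 c2) 0)" if "c1\<^sup>2 + c2\<^sup>2 > 0" for c1 c2
    using harmonic_u_poly zero_in_frontier_u_poly[OF that] hJ_u_poly_decreasing[OF assms that] by blast
  show ?thesis
  proof (intro conjI allI impI exI)
    show "open (UNIV :: heis set)" by simp
    show "0 \<in> frontier {p \<in> UNIV. 0 < u_poly 1 0 p} \<inter> UNIV" using *[of 1 0] by simp
  qed (use *[of 1 0] * in auto)
qed

end
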